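(* The equation $S\!E_5(a,b,c,g,p,q)$ admits shift operators for each of the shifts $a\to a\pm1$, $b\to b\pm1$, $c\to c\pm1$, $g\to g\pm2$, $p\to p\pm1$ and $q\to q\pm1$ (in each shift the other parameters are kept fixed).
   Context: Notation: $\partial=d/dx$, $\theta=x\partial$; $a,b,c,g,p,q$ are complex parameters, assumed generic. The operator $E_6(e_1,\dots,e_9)$: put $s=(6-e_1-\cdots-e_9)/3$ and $s_{11}=e_1+e_2+e_3$, $s_{12}=e_4+e_5+e_6$, $s_{13}=e_7+e_8+e_9$, $s_{21}=e_1e_2+e_1e_3+e_2e_3$, $s_{22}=e_4e_5+e_4e_6+e_5e_6$, $s_{23}=e_7e_8+e_7e_9+e_8e_9$, $s_{31}=e_1e_2e_3$, $s_{32}=e_4e_5e_6$, $s_{33}=e_7e_8e_9$. Then $E_6=T_0+T_1\partial+T_2\partial^2+T_3\partial^3$ with $T_0=(\theta+s+2)(\theta+s+1)(\theta+s)(\theta+e_7)(\theta+e_8)(\theta+e_9)$, $T_1=(\theta+s+2)(\theta+s+1)B_1$, $B_1=T_{13}\theta^3+T_{12}\theta^2+T_{11}\theta+T_{10}$, $T_2=(\theta+s+2)B_2$, $B_2=T_{23}\theta^3+T_{22}\theta^2+T_{21}\theta+T_{20}$, $T_3=-(\theta+3-e_1)(\theta+3-e_2)(\theta+3-e_3)$, where $T_{13}=-3$, $T_{23}=3$, $T_{12}=-9+s_{11}-2s_{13}$, $T_{22}=18+s_{13}-2s_{11}$, $T_{11}=-8+(s_{11}^2+2s_{11}s_{13}-s_{12}^2+s_{13}^2)/3+s_{11}-5s_{13}-s_{21}+s_{22}-2s_{23}$,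 $T_{21}=35+(-s_{11}^2-2s_{11}s_{13}+s_{12}^2-s_{13}^2)/3-7s_{11}+5s_{13}+2s_{21}-s_{22}+s_{23}$, $T_{20}=-T_{10}+19+(s_{11}^2s_{13}-s_{11}s_{12}^2+s_{11}s_{13}^2-s_{12}^2s_{13})/9+(s_{13}^3+s_{11}^3-2s_{12}^3)/27+(-2s_{11}^2-4s_{11}s_{13}+s_{11}s_{22}+2s_{12}^2+s_{22}s_{12}-2s_{13}^2+s_{22}s_{13})/3-5s_{11}+4s_{13}+3s_{21}-2s_{22}-s_{31}-s_{32}-s_{33}$, $2T_{10}=(2s_{11}+s_{11}^2+2s_{11}s_{13}-s_{12}^2+s_{13}^2-s_{11}s_{21}+2s_{11}s_{23}+s_{12}s_{22}-2s_{13}s_{21}+2s_{13}s_{22}+s_{13}s_{23}-14s_{13})/3+2(s_{11}^2s_{13}-s_{12}^2s_{13})/9+2(s_{11}^3-s_{12}^3)/27-5-s_{21}+s_{31}+s_{22}-s_{32}-5s_{23}-3s_{33}$. The operator $E_5(e_1,\dots,e_8)$ is the order 5 operator determined by $E_6(e_1,\dots,e_8,0)=E_5(e_1,\dots,e_8)\circ\partial$. Explicitly $E_5=x\overline T_0+\overline T_1+\overline T_2\partial+\overline T_3\partial^2$ with $\overline T_0=(\theta+s+1)(\theta+s+2)(\theta+s+3)(\theta+e_7+1)(\theta+e_8+1)$, $\overline T_1=(\theta+s+1)(\theta+s+2)B_1|_{e_9=0}$, $\overline T_2=(\theta+s+2)B_2|_{e_9=0}$, $\overline T_3=T_3$. The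 operator $S\!E_5(a,b,c,g,p,q)$ is $E_5(e_1,\dots,e_8)$ with $e_1=-2a-2b-2c-g-q-2$, $e_2=-a-c-2b-g-q-1$, $e_3=-2b-q$, $e_4=-2a-2b-2c-g-p-2$, $e_5=-b-c-2a-g-p-1$, $e_6=-2a-p$, $e_7=2a+2b+g+2$, $e_8=a+b+1$ (so $-s=r:=-2a-2b-2c-g-p-q-3$). Shift operator: let $E(\mathbf a)\in\mathbb C(x)[\partial]$ be an operator of order $n$ depending on parameters $\mathbf a$ and let $\mathbf a\to sh(\mathbf a)$ be a shift of the parameters. A shift operator of $E$ for this shift is a non-zero operator $P\in\mathbb C(x)[\partial]$ of order lower than $n$ that sends the solution space of $E(\mathbf a)$ into that of $E(sh(\mathbf a))$; equivalently, there is $Q\in\mathbb C(x)[\partial]$ with $E(sh(\mathbf a))\circ P=Q\circ E(\mathbf a)$. *)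

theory Defs
  imports "HOL-Computational_Algebra.Computational_Algebra"
begin

section \<open>The ring \<open>\<complex>(x)[\<partial>]\<close> of ordinary differential operators\<close>

type_synonym ratfun = "complex poly fract"

text \<open>The quotient rule applied to some representation as a fraction; lemma
  \<open>fract_deriv_Fract\<close> below shows that the choice does not matter.\<close>

definition fract_deriv :: "'a :: idom poly fract \<Rightarrow> 'a poly fract" where
  "fract_deriv f = (let (u, v) = (SOME (u, v). v \<noteq> 0 \<and> f = Fract u v)
     in Fract (pderiv u * v - u * pderiv v) (v * v))"

lemma fract_deriv_Fract:
  assumes "v \<noteq> 0"
  shows "fract_deriv (Fract u v) = Fract (pderiv u * v - u * pderiv v) (v * v)"
proof -
  obtain u' v' where eq: "(SOME (u', v'). v' \<noteq> 0 \<and> Fract u v = Fract u' v') = (u', v')"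
    by fastforce
  have "case (u', v') of (u', v') \<Rightarrow> v' \<noteq> 0 \<and> Fract u v = Fract u' v'"
    unfolding eq[symmetric] by (rule someI[of _ "(u, v)"]) (use assms in simp)
  hence v': "v' \<noteq> 0" and "u * v' = u' * v"
    using assms by (auto simp: eq_fract)
  hence "pderiv (u * v') = pderiv (u' * v)"
    by simp
  hence *: "pderiv u * v' + u * pderiv v' = pderiv u' * v + u' * pderiv v"
    by (simp add: pderiv_mult algebra_simps)
  have "(pderiv u * v - u * pderiv v) * (v' * v') - (pderiv u' * v' - u' * pderiv v') * (v * v)
      = v * v' * ((pderiv u * v' + u * pderiv v') - (pderiv u' * v + u' * pderiv v))
        - (u * v' - u' * v) * (pderiv v * v' + v * pderiv v')"
    by (simp add: algebra_simps)
  hence "(pderiv u' * v' - u' * pderiv v') * (v * v) = (pderiv u * v - u * pderiv v) * (v' * v')"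
    using * \<open>u * v' = u' * v\<close> by simp
  thus ?thesis
    using assms v' by (simp add: fract_deriv_def eq eq_fract)
qed

lemma fract_deriv_0 [simp]: "fract_deriv 0 = 0"
  using fract_deriv_Fract[of 1 0] by (simp add: fract_collapse)

lemma fract_deriv_1 [simp]: "fract_deriv 1 = 0"
  using fract_deriv_Fract[of 1 1] by (simp add: fract_collapse)

lemma fract_deriv_to_fract: "fract_deriv (to_fract u) = to_fract (pderiv u)"
  by (simp add: to_fract_def fract_deriv_Fract)

lemma fract_deriv_add: "fract_deriv (f + g) = fract_deriv f + fract_deriv g"
proof -
  obtain u v where f: "f = Fract u v" "v \<noteq> 0" by (cases f) auto
  obtain u' v' where g: "g = Fract u' v'" "v' \<noteq> 0" by (cases g) auto
  show ?thesis
    unfolding f g using f(2) g(2)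
    by (simp add: fract_deriv_Fract eq_fract pderiv_mult pderiv_add) algebra
qed

lemma fract_deriv_mult: "fract_deriv (f * g) = fract_deriv f * g + f * fract_deriv g"
proof -
  obtain u v where f: "f = Fract u v" "v \<noteq> 0" by (cases f) auto
  obtain u' v' where g: "g = Fract u' v'" "v' \<noteq> 0" by (cases g) auto
  show ?thesis
    unfolding f g using f(2) g(2)
    by (simp add: fract_deriv_Fract eq_fract pderiv_mult) algebra
qed

text \<open>The polynomial \<open>\<Sum>i. f\<^sub>i X^i\<close> stands for the operator \<open>\<Sum>i. f\<^sub>i \<partial>^i\<close>,
  coefficients on the left. In these terms \<open>D_left A\<close> is
  \<open>\<partial> \<circ> A\<close>, since \<open>\<partial> \<circ> f\<partial>^i = f'\<partial>^i + f\<partial>^(i+1)\<close>.\<close>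

definition D_left :: "ratfun poly \<Rightarrow> ratfun poly" where
  "D_left A = map_poly fract_deriv A + pCons 0 A"

definition op_comp :: "ratfun poly \<Rightarrow> ratfun poly \<Rightarrow> ratfun poly" where
  "op_comp A B = (\<Sum>i\<le>degree A. smult (coeff A i) ((D_left ^^ i) B))"

lemma coeff_D_left:
  "coeff (D_left A) n = fract_deriv (coeff A n) + (if n = 0 then 0 else coeff A (n - 1))"
  by (simp add: D_left_def coeff_map_poly coeff_pCons split: nat.splits)

lemma D_left_0 [simp]: "D_left 0 = 0"
  by (simp add: D_left_def)

lemma D_left_add: "D_left (A + B) = D_left A + D_left B"
  by (rule poly_eqI) (simp add: coeff_D_left fract_deriv_add)

lemma D_left_sum: "D_left (sum F I) = (\<Sum>i\<in>I. D_left (F i))"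
  by (induction I rule: infinite_finite_induct) (simp_all add: D_left_add)

lemma D_left_smult: "D_left (smult f A) = smult (fract_deriv f) A + smult f (D_left A)"
  by (rule poly_eqI) (simp add: coeff_D_left fract_deriv_mult algebra_simps)

lemma D_left_pow_0 [simp]: "(D_left ^^ i) 0 = 0"
  by (induction i) simp_all

lemma D_left_pow_add: "(D_left ^^ i) (A + B) = (D_left ^^ i) A + (D_left ^^ i) B"
  by (induction i) (simp_all add: D_left_add)

lemma D_left_pow_1: "(D_left ^^ i) 1 = monom 1 i"
proof (induction i)
  case (Suc i)
  show ?case
    by (rule poly_eqI) (auto simp: Suc coeff_D_left)
qed simp

lemma degree_D_left_le: "degree (D_left A) \<le> Suc (degree A)"
  by (rule degree_le) (auto simp: coeff_D_left coeff_eq_0)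

lemma op_comp_eq:
  assumes "degree A \<le> n"
  shows "op_comp A B = (\<Sum>i\<le>n. smult (coeff A i) ((D_left ^^ i) B))"
  unfolding op_comp_def using assms
  by (intro sum.mono_neutral_left) (auto simp: coeff_eq_0)

lemma op_comp_add_left: "op_comp (A + A') B = op_comp A B + op_comp A' B"
proof -
  define n where "n = max (degree A) (degree A')"
  have "degree (A + A') \<le> n" "degree A \<le> n" "degree A' \<le> n"
    by (auto simp: n_def degree_add_le_max)
  thus ?thesis
    by (simp add: op_comp_eq[of _ n] smult_add_left sum.distrib)
qed

lemma op_comp_0_left [simp]: "op_comp 0 B = 0"
  by (simp add: op_comp_def)

lemma op_comp_sum_left: "op_comp (sum F I) B = (\<Sum>i\<in>I. op_comp (F i) B)"
  by (induction I rule: infinite_finite_induct) (simp_all add: op_comp_add_left)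

lemma op_comp_smult_left: "op_comp (smult f A) B = smult f (op_comp A B)"
proof -
  have smult_sum: "smult f (sum F I) = (\<Sum>i\<in>I. smult f (F i))" for F :: "nat \<Rightarrow> _" and I
    by (induction I rule: infinite_finite_induct) (simp_all add: smult_add_right)
  show ?thesis
    using op_comp_eq[of "smult f A" "degree A" B] by (simp add: op_comp_def smult_sum)
qed

lemma op_comp_add_right: "op_comp A (B + B') = op_comp A B + op_comp A B'"
  by (simp add: op_comp_def D_left_pow_add smult_add_right sum.distrib)

lemma op_comp_1_left: "op_comp 1 B = B"
  by (simp add: op_comp_def)

lemma op_comp_1_right: "op_comp A 1 = A"
  by (simp add: op_comp_def D_left_pow_1 smult_monom poly_as_sum_of_monoms)

lemma op_comp_D_left: "op_comp (D_left A) B = D_left (op_comp A B)"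
proof -
  define n where "n = degree A"
  have A0: "coeff A (Suc n) = 0" by (simp add: n_def coeff_eq_0)
  have "op_comp (D_left A) B = (\<Sum>i\<le>Suc n. smult (coeff (D_left A) i) ((D_left ^^ i) B))"
    by (rule op_comp_eq) (simp add: n_def degree_D_left_le)
  also have "\<dots> = (\<Sum>i\<le>Suc n. smult (fract_deriv (coeff A i)) ((D_left ^^ i) B)) +
      (\<Sum>i\<le>Suc n. smult (if i = 0 then 0 else coeff A (i - 1)) ((D_left ^^ i) B))"
    by (simp only: coeff_D_left smult_add_left sum.distrib)
  also have "(\<Sum>i\<le>Suc n. smult (fract_deriv (coeff A i)) ((D_left ^^ i) B))
      = (\<Sum>i\<le>n. smult (fract_deriv (coeff A i)) ((D_left ^^ i) B))"
    by (simp add: A0)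
  also have "(\<Sum>i\<le>Suc n. smult (if i = 0 then 0 else coeff A (i - 1)) ((D_left ^^ i) B))
      = (\<Sum>i\<le>n. smult (coeff A i) ((D_left ^^ Suc i) B))"
    by (subst sum.atMost_Suc_shift) simp
  finally show ?thesis
    by (simp add: op_comp_def n_def D_left_sum D_left_smult sum.distrib)
qed

lemma op_comp_D_left_pow: "op_comp ((D_left ^^ i) A) B = (D_left ^^ i) (op_comp A B)"
  by (induction i) (simp_all add: op_comp_D_left)

lemma op_comp_assoc: "op_comp (op_comp A B) C = op_comp A (op_comp B C)"
proof -
  have "op_comp (op_comp A B) C
      = op_comp (\<Sum>i\<le>degree A. smult (coeff A i) ((D_left ^^ i) B)) C"
    by (simp only: op_comp_def[of A B])
  also have "\<dots> = op_comp A (op_comp B C)"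
    by (simp add: op_comp_sum_left op_comp_smult_left op_comp_D_left_pow
        op_comp_def[of A "op_comp B C"])
  finally show ?thesis .
qed

typedef diffop = "UNIV :: ratfun poly set"
  morphisms op_poly Diffop
  by simp

setup_lifting type_definition_diffop

instantiation diffop :: ring_1
begin

lift_definition zero_diffop :: diffop is 0 .
lift_definition one_diffop :: diffop is 1 .
lift_definition plus_diffop :: "diffop \<Rightarrow> diffop \<Rightarrow> diffop" is "(+)" .
lift_definition minus_diffop :: "diffop \<Rightarrow> diffop \<Rightarrow> diffop" is "(-)" .
lift_definition uminus_diffop :: "diffop \<Rightarrow> diffop" is uminus .
lift_definition times_diffop :: "diffop \<Rightarrow> diffop \<Rightarrow> diffop" is op_comp .

instance
  by standard (transfer; simp add: op_comp_assoc op_comp_add_left op_comp_add_right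
      op_comp_1_left op_comp_1_right algebra_simps)+

end

lift_definition op_order :: "diffop \<Rightarrow> nat" is degree .

definition fun_op :: "ratfun \<Rightarrow> diffop" where
  "fun_op f = Diffop [:f:]"

lift_definition D_op :: diffop is "[:0, 1:]" .

definition const_op :: "complex \<Rightarrow> diffop" where
  "const_op c = fun_op (to_fract [:c:])"

definition x_op :: diffop where
  "x_op = fun_op (to_fract [:0, 1:])"

definition theta_op :: diffop where
  "theta_op = x_op * D_op"

lemma op_poly_fun_op: "op_poly (fun_op f) = [:f:]"
  by (simp add: fun_op_def Diffop_inverse)

lemmas op_poly_rep_eqs = op_poly_fun_op D_op.rep_eq zero_diffop.rep_eq one_diffop.rep_eq
  plus_diffop.rep_eq times_diffop.rep_eq

lemma D_op_fun_op: "D_op * fun_op f = fun_op f * D_op + fun_op (fract_deriv f)"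
  by (simp add: op_poly_rep_eqs op_comp_def D_left_def map_poly_pCons flip: op_poly_inject)

lemma fun_op_add: "fun_op (f + g) = fun_op f + fun_op g"
  by (simp add: op_poly_rep_eqs flip: op_poly_inject)

lemma fun_op_mult: "fun_op (f * g) = fun_op f * fun_op g"
  by (simp add: op_poly_rep_eqs op_comp_def flip: op_poly_inject)

lemma const_op_add: "const_op (c + d) = const_op c + const_op d"
  using fun_op_add[of "to_fract [:c:]" "to_fract [:d:]"]
  by (simp add: const_op_def flip: to_fract_add)

lemma fun_op_0 [simp]: "fun_op 0 = 0"
  by (simp add: op_poly_rep_eqs flip: op_poly_inject)

lemma fun_op_1 [simp]: "fun_op 1 = 1"
  by (simp add: op_poly_rep_eqs pCons_one flip: op_poly_inject)

lemma const_op_0: "const_op 0 = 0"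
  by (simp add: const_op_def)

lemma const_op_1: "const_op 1 = 1"
  by (simp add: const_op_def pCons_one)

lemma D_op_x_op: "D_op * x_op = x_op * D_op + 1"
  by (simp add: x_op_def D_op_fun_op fract_deriv_to_fract pderiv_pCons pCons_one)

lemma x_op_const_op: "x_op * const_op c = const_op c * x_op"
  by (simp add: x_op_def const_op_def mult.commute flip: fun_op_mult)


section \<open>The operators \<open>E\<^sub>6\<close>, \<open>E\<^sub>5\<close> and \<open>SE\<^sub>5\<close>\<close>

text \<open>The tuple \<open>(e\<^sub>1, \<dots>, e\<^sub>9)\<close> is a function \<open>e\<close> of which only the values
  \<open>e 1, \<dots>, e 9\<close> matter.\<close>

context
  fixes e :: "nat \<Rightarrow> complex"
begin

definition "es = (6 - (\<Sum>i=1..9. e i)) / 3"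

definition "s11 = e 1 + e 2 + e 3"
definition "s12 = e 4 + e 5 + e 6"
definition "s13 = e 7 + e 8 + e 9"
definition "s21 = e 1 * e 2 + e 1 * e 3 + e 2 * e 3"
definition "s22 = e 4 * e 5 + e 4 * e 6 + e 5 * e 6"
definition "s23 = e 7 * e 8 + e 7 * e 9 + e 8 * e 9"
definition "s31 = e 1 * e 2 * e 3"
definition "s32 = e 4 * e 5 * e 6"
definition "s33 = e 7 * e 8 * e 9"

definition T13 :: complex where "T13 = -3"
definition T23 :: complex where "T23 = 3"
definition "T12 = -9 + s11 - 2 * s13"
definition "T22 = 18 + s13 - 2 * s11"

definition "T11 = -8 + (s11^2 + 2 * s11 * s13 - s12^2 + s13^2) / 3
  + s11 - 5 * s13 - s21 + s22 - 2 * s23"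

definition "T21 = 35 + (- (s11^2) - 2 * s11 * s13 + s12^2 - s13^2) / 3
  - 7 * s11 + 5 * s13 + 2 * s21 - s22 + s23"

definition "T10 =
  ((2 * s11 + s11^2 + 2 * s11 * s13 - s12^2 + s13^2 - s11 * s21 + 2 * s11 * s23
      + s12 * s22 - 2 * s13 * s21 + 2 * s13 * s22 + s13 * s23 - 14 * s13) / 3
    + 2 * (s11^2 * s13 - s12^2 * s13) / 9
    + 2 * (s11^3 - s12^3) / 27
    - 5 - s21 + s31 + s22 - s32 - 5 * s23 - 3 * s33) / 2"

definition "T20 = - T10 + 19
  + (s11^2 * s13 - s11 * s12^2 + s11 * s13^2 - s12^2 * s13) / 9
  + (s13^3 + s11^3 - 2 * s12^3) / 27
  + (- 2 * s11^2 - 4 * s11 * s13 + s11 * s22 + 2 * s12^2 + s22 * s12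
      - 2 * s13^2 + s22 * s13) / 3
  - 5 * s11 + 4 * s13 + 3 * s21 - 2 * s22 - s31 - s32 - s33"

definition B1 :: diffop where
  "B1 = const_op T13 * theta_op^3 + const_op T12 * theta_op^2
      + const_op T11 * theta_op + const_op T10"

definition B2 :: diffop where
  "B2 = const_op T23 * theta_op^3 + const_op T22 * theta_op^2
      + const_op T21 * theta_op + const_op T20"

definition T0 :: diffop where
  "T0 = (theta_op + const_op (es + 2)) * (theta_op + const_op (es + 1)) * (theta_op + const_op es)
      * (theta_op + const_op (e 7)) * (theta_op + const_op (e 8)) * (theta_op + const_op (e 9))"

definition T1 :: diffop where
  "T1 = (theta_op + const_op (es + 2)) * (theta_op + const_op (es + 1)) * B1"

definition T2 :: diffop where
  "T2 = (theta_op + const_op (es + 2)) * B2"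

definition T3 :: diffop where
  "T3 = - ((theta_op + const_op (3 - e 1)) * (theta_op + const_op (3 - e 2))
      * (theta_op + const_op (3 - e 3)))"

definition E6 :: diffop where
  "E6 = T0 + T1 * D_op + T2 * D_op^2 + T3 * D_op^3"

end

text \<open>\<open>E5\<close> only depends on \<open>e 1, \<dots>, e 8\<close>; lemma \<open>E6_eq_E5_D_op\<close> below is the
  characterization \<open>E\<^sub>6(e\<^sub>1,\<dots>,e\<^sub>8,0) = E\<^sub>5(e\<^sub>1,\<dots>,e\<^sub>8) \<circ> \<partial>\<close>.\<close>

definition E5 :: "(nat \<Rightarrow> complex) \<Rightarrow> diffop" where
  "E5 e' = (let e = e'(9 := 0); s = es e in
     x_op * ((theta_op + const_op (s + 1)) * (theta_op + const_op (s + 2))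
       * (theta_op + const_op (s + 3)) * (theta_op + const_op (e 7 + 1))
       * (theta_op + const_op (e 8 + 1)))
     + (theta_op + const_op (s + 1)) * (theta_op + const_op (s + 2)) * B1 e
     + (theta_op + const_op (s + 2)) * B2 e * D_op
     + T3 e * D_op^2)"

lemma const_op_commute: "const_op c * const_op d = const_op d * const_op c"
  by (simp add: const_op_def mult.commute flip: fun_op_mult)

lemma theta_op_const_op: "theta_op * const_op c = const_op c * theta_op"
proof -
  have "D_op * const_op c = const_op c * D_op"
    by (simp add: const_op_def D_op_fun_op fract_deriv_to_fract)
  hence "theta_op * const_op c = x_op * const_op c * D_op"
    by (simp add: theta_op_def mult.assoc)
  thus ?thesis by (simp add: x_op_const_op theta_op_def mult.assoc)
qed

lemma theta_op_shift_x: "(theta_op + const_op c) * x_op = x_op * (theta_op + const_op (c + 1))"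
  by (simp add: theta_op_def D_op_x_op x_op_const_op const_op_add const_op_1 algebra_simps)

lemma theta_op_factors_commute:
  "(theta_op + const_op c) * (theta_op + const_op d)
     = (theta_op + const_op d) * (theta_op + const_op c)"
  by (simp add: algebra_simps theta_op_const_op const_op_commute)

lemma E6_eq_E5_D_op: "E6 (e(9 := 0)) = E5 e * D_op"
proof -
  define t where "t c = theta_op + const_op c" for c
  define s where "s = es (e(9 := 0))"
  have tx: "t c * (x_op * A) = x_op * (t (c + 1) * A)" for c A
    using theta_op_shift_x[of c] by (simp add: t_def flip: mult.assoc)
  have tt: "t c * t d = t d * t c" for c d
    by (simp add: t_def theta_op_factors_commute)
  have tt': "t c * (t d * A) = t d * (t c * A)" for c d A
    by (metis mult.assoc tt)
  have "T0 (e(9 := 0)) = t (s + 2) * t (s + 1) * t s * t (e 7) * t (e 8) * (x_op * D_op)"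
    by (simp add: T0_def t_def s_def const_op_0 flip: theta_op_def)
  also have "\<dots> = x_op * (t (s + 3) * (t (s + 2) * (t (s + 1) * (t (e 7 + 1) * (t (e 8 + 1) * D_op)))))"
    by (simp add: mult.assoc tx add.assoc)
  also have "\<dots> = x_op * (t (s + 1) * t (s + 2) * t (s + 3) * t (e 7 + 1) * t (e 8 + 1)) * D_op"
    by (simp only: mult.assoc tt'[of "s + 3"] tt'[of "s + 2" "s + 1"])
  finally have T0: "T0 (e(9 := 0)) = \<dots>" .
  show ?thesis
    unfolding E6_def E5_def Let_def T0 T1_def T2_def
      s_def[symmetric] t_def[symmetric] tt[of "s + 2" "s + 1"]
    by (simp add: distrib_right mult.assoc power2_eq_square power3_eq_cube)
qed

definition SE5 :: "complex \<Rightarrow> complex \<Rightarrow> complex \<Rightarrow> complex \<Rightarrow> complex \<Rightarrow> complex \<Rightarrow> diffop" where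
  "SE5 a b c g p q = E5 (\<lambda>i.
     [ - 2*a - 2*b - 2*c - g - q - 2,
       - a - c - 2*b - g - q - 1,
       - 2*b - q,
       - 2*a - 2*b - 2*c - g - p - 2,
       - b - c - 2*a - g - p - 1,
       - 2*a - p,
       2*a + 2*b + g + 2,
       a + b + 1 ] ! (i - 1))"


section \<open>Shift operators and generic parameters\<close>

text \<open>\<open>E\<close> is the operator at the given parameters and \<open>E'\<close> the one at the shifted parameters.
  The existence of \<open>Q\<close> expresses that \<open>P\<close> sends solutions of \<open>E\<close> to solutions of \<open>E'\<close>.\<close>

definition shift_operator :: "diffop \<Rightarrow> diffop \<Rightarrow> diffop \<Rightarrow> bool" where
  "shift_operator E E' P \<longleftrightarrow> P \<noteq> 0 \<and> op_order P < op_order E \<and> (\<exists>Q. E' * P = Q * E)"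

inductive polyfun6 ::
  "(complex \<Rightarrow> complex \<Rightarrow> complex \<Rightarrow> complex \<Rightarrow> complex \<Rightarrow> complex \<Rightarrow> complex) \<Rightarrow> bool" where
  "polyfun6 (\<lambda>a b c g p q. k)"
| "polyfun6 (\<lambda>a b c g p q. a)"
| "polyfun6 (\<lambda>a b c g p q. b)"
| "polyfun6 (\<lambda>a b c g p q. c)"
| "polyfun6 (\<lambda>a b c g p q. g)"
| "polyfun6 (\<lambda>a b c g p q. p)"
| "polyfun6 (\<lambda>a b c g p q. q)"
| "polyfun6 F \<Longrightarrow> polyfun6 G \<Longrightarrow> polyfun6 (\<lambda>a b c g p q. F a b c g p q + G a b c g p q)"
| "polyfun6 F \<Longrightarrow> polyfun6 G \<Longrightarrow> polyfun6 (\<lambda>a b c g p q. F a b c g p q * G a b c g p q)"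

text \<open>A property holds for generic parameters if it holds off the zero set of some
  polynomial that is not identically zero.\<close>

definition generically ::
  "(complex \<Rightarrow> complex \<Rightarrow> complex \<Rightarrow> complex \<Rightarrow> complex \<Rightarrow> complex \<Rightarrow> bool) \<Rightarrow> bool" where
  "generically \<Phi> \<longleftrightarrow> (\<exists>F. polyfun6 F \<and> (\<exists>a b c g p q. F a b c g p q \<noteq> 0) \<and>
     (\<forall>a b c g p q. F a b c g p q \<noteq> 0 \<longrightarrow> \<Phi> a b c g p q))"

end

theory Submission
  imports Defs
begin

text \<open>If \<open>E'P = QE\<close> and \<open>U P + V E = 1\<close> for operators \<open>E\<close>, \<open>E'\<close> of the same order, then \<open>P\<close> maps the
  solution space of \<open>E\<close> bijectively onto that of \<open>E'\<close>. The existence of such a \<open>P\<close> is an equivalence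
  relation between \<open>E\<close> and \<open>E'\<close>, and the remainder of \<open>P\<close> modulo \<open>E\<close> is a shift operator. Hence it is
  enough to treat generators of the lattice of shifts. For \<open>p\<close> and \<open>q\<close>, which only enter through a
  middle convolution, \<open>\<theta> + s + 1\<close> and \<open>\<theta> - \<partial> + s + 1\<close> do. For \<open>(a, g, p) \<rightarrow> (a - 1, g + 2, p + 1)\<close>,
  for \<open>(a, c, g, p, q) \<rightarrow> (a - 1, c - 1, g + 2, p + 2, q + 1)\<close> and for \<open>a \<rightarrow> a + 1\<close> there are explicit
  \<open>P\<close> of orders 3, 3 and 4. A suitable operator \<open>U\<close> in the opposite direction leads back to the original
  \<open>a, b, c, g\<close>, with other values of \<open>p, q\<close>; so Bezout's identity takes the form \<open>U P + V E = k T\<close>, with a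
  product \<open>T\<close> of the operators for \<open>p\<close> and \<open>q\<close> and a polynomial \<open>k\<close> in the parameters. The first of these
  generators has a mirror image under a symmetry that exchanges \<open>e\<^sub>4\<close> and \<open>e\<^sub>6\<close>. The coefficients
  of \<open>P, Q, U, V\<close> were found by solving linear systems.\<close>

subsection \<open>Right division in the ring of differential operators\<close>

text \<open>Since \<partial> f \<partial>^i = f \<partial>^(i+1) + f' \<partial>^i, the derivative
  of a coefficient never reaches the new top degree.\<close>

lemma lead_D_left_pow:
  assumes "B \<noteq> 0"
  shows "degree ((D_left ^^ i) B) = degree B + i \<and> lead_coeff ((D_left ^^ i) B) = lead_coeff B"
proof (induction i)
  case (Suc i)
  define C where "C = (D_left ^^ i) B"
  have C: "degree C = degree B + i" "lead_coeff C = lead_coeff B"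
    using Suc by (auto simp: C_def)
  have c: "coeff (D_left C) (Suc (degree C)) = lead_coeff B"
    using C by (simp add: coeff_D_left coeff_eq_0)
  moreover have "degree (D_left C) = Suc (degree C)"
    using assms c by (intro antisym degree_D_left_le le_degree) auto
  ultimately show ?case using C by (simp add: C_def)
qed simp

lemma op_comp_degree:
  assumes "A \<noteq> 0" "B \<noteq> 0"
  shows "degree (op_comp A B) = degree A + degree B"
proof (rule antisym)
  show "degree (op_comp A B) \<le> degree A + degree B"
    unfolding op_comp_def using lead_D_left_pow[OF assms(2)]
    by (intro degree_sum_le) (auto intro!: order.trans[OF degree_smult_le])
  have lead: "coeff ((D_left ^^ degree A) B) (degree A + degree B) = lead_coeff B"
    using lead_D_left_pow[OF assms(2), of "degree A"] by (metis add.commute)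
  have "coeff (op_comp A B) (degree A + degree B)
      = (\<Sum>i\<le>degree A. coeff A i * coeff ((D_left ^^ i) B) (degree A + degree B))"
    by (simp add: op_comp_def coeff_sum)
  also have "\<dots> = (\<Sum>i\<le>degree A. if i = degree A then lead_coeff A * lead_coeff B else 0)"
    using lead_D_left_pow[OF assms(2)]
    by (intro sum.cong refl) (auto simp: coeff_eq_0 lead)
  also have "\<dots> = lead_coeff A * lead_coeff B"
    by simp
  finally show "degree A + degree B \<le> degree (op_comp A B)"
    using assms by (intro le_degree) auto
qed

lemma op_poly_eq_0_iff [simp]: "op_poly A = 0 \<longleftrightarrow> A = 0"
  by (metis op_poly_inject zero_diffop.rep_eq)

lemma op_order_mult:
  assumes "A \<noteq> 0" "B \<noteq> 0"
  shows "op_order (A * B) = op_order A + op_order B"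
  using assms by (simp add: op_order.rep_eq times_diffop.rep_eq op_comp_degree)

lemma diffop_mult_eq_0_iff [simp]: "A * B = 0 \<longleftrightarrow> A = 0 \<or> B = (0 :: diffop)"
proof -
  have "op_comp f g \<noteq> 0" if "f \<noteq> 0" "g \<noteq> 0" for f g
  \<comment> \<open>In total degree 0 the degree formula does not tell 0 from a non-zero function,
    so this case is computed directly.\<close>
  proof (cases "degree f + degree g = 0")
    case True
    then obtain x y where "f = [:x:]" "g = [:y:]"
      by (metis add_is_0 degree_eq_zeroE)
    thus ?thesis using that by (simp add: op_comp_def)
  next
    case False
    thus ?thesis using op_comp_degree[OF that] by auto
  qed
  thus ?thesis
    by (metis mult_zero_left mult_zero_right op_poly_eq_0_iff times_diffop.rep_eq)
qed

lemma op_order_1 [simp]: "op_order 1 = 0"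
  by (simp add: op_order.rep_eq one_diffop.rep_eq)

lemma diffop_right_division:
  assumes "B \<noteq> 0"
  shows "\<exists>Q R. A = Q * B + R \<and> (R = 0 \<or> op_order R < op_order B)"
\<comment> \<open>The zero operator has order 0, like a non-zero function; the measure puts it
  strictly below.\<close>
proof (induction "if A = 0 then 0 else Suc (op_order A)" arbitrary: A rule: less_induct)
  case less
  show ?case
  proof (cases "A = 0 \<or> op_order A < op_order B")
    case True
    thus ?thesis by (intro exI[of _ 0] exI[of _ A]) auto
  next
    case False
    hence nz: "A \<noteq> 0" and ge: "op_order B \<le> op_order A" by auto
    define k where "k = op_order A - op_order B"
    define c where "c = lead_coeff (op_poly A) / lead_coeff (op_poly B)"
    \<comment> \<open>\<open>M\<close> is c \<partial>^k, chosen so that \<open>M * B\<close> has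
      the same leading term as \<open>A\<close>.\<close>
    define M where "M = Diffop (monom c k)"
    define A' where "A' = A - M * B"
    have rep: "op_poly A' = op_poly A - smult c ((D_left ^^ k) (op_poly B))"
    proof -
      have "op_comp (monom c k) (op_poly B) = smult c ((D_left ^^ k) (op_poly B))"
      proof -
        have "op_comp (monom c k) (op_poly B)
            = (\<Sum>i\<le>k. smult (coeff (monom c k) i) ((D_left ^^ i) (op_poly B)))"
          by (rule op_comp_eq) (simp add: degree_monom_le)
        also have "\<dots> = (\<Sum>i\<le>k. if i = k then smult c ((D_left ^^ k) (op_poly B)) else 0)"
          by (intro sum.cong) auto
        finally show ?thesis by simp
      qed
      thus ?thesis
        by (simp add: A'_def M_def minus_diffop.rep_eq times_diffop.rep_eq Diffop_inverse)
    qed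
    have B: "op_poly B \<noteq> 0" using assms by simp
    have dg: "degree ((D_left ^^ k) (op_poly B)) = op_order A"
      "lead_coeff ((D_left ^^ k) (op_poly B)) = lead_coeff (op_poly B)"
      using lead_D_left_pow[OF B, of k] ge by (auto simp: k_def op_order.rep_eq)
    have le: "degree (op_poly A') \<le> op_order A"
      unfolding rep using dg
      by (intro degree_diff_le order.trans[OF degree_smult_le]) (auto simp: op_order.rep_eq)
    have "coeff (op_poly A') (op_order A) = 0"
      using dg B by (simp add: rep c_def op_order.rep_eq)
    hence "A' = 0 \<or> op_order A' < op_order A"
      using le by (metis leading_coeff_0_iff le_neq_implies_less op_order.rep_eq op_poly_eq_0_iff)
    hence "\<exists>Q R. A' = Q * B + R \<and> (R = 0 \<or> op_order R < op_order B)"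
      using nz by (intro less) auto
    then obtain Q R where "A' = Q * B + R" "R = 0 \<or> op_order R < op_order B" by blast
    thus ?thesis
      by (intro exI[of _ "Q + M"] exI[of _ R]) (auto simp: A'_def algebra_simps)
  qed
qed

subsection \<open>Equivalence of differential operators\<close>

text \<open>The first conjunct says that \<open>P\<close> maps solutions of \<open>E\<close> to
  solutions of \<open>E'\<close>. The second says that \<open>P\<close> and \<open>E\<close> have no
  common right factor, so that \<open>P\<close> is injective on these solutions.\<close>

definition intertwines :: "diffop \<Rightarrow> diffop \<Rightarrow> diffop \<Rightarrow> bool" where
  "intertwines P E E' \<longleftrightarrow> (\<exists>Q. E' * P = Q * E) \<and> (\<exists>U V. U * P + V * E = 1)"

text \<open>For the Bezout part, the relation of \<open>P'\<close> is inserted between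
  \<open>U\<close> and \<open>P\<close>, and \<open>E' * P\<close> is replaced by
  \<open>Q * E\<close>.\<close>

lemma intertwines_mult:
  assumes "intertwines P E E'" "intertwines P' E' E''"
  shows "intertwines (P' * P) E E''"
proof -
  obtain Q U V where 1: "E' * P = Q * E" "U * P + V * E = 1"
    using assms(1) by (auto simp: intertwines_def)
  obtain Q' U' V' where 2: "E'' * P' = Q' * E'" "U' * P' + V' * E' = 1"
    using assms(2) by (auto simp: intertwines_def)
  have "E'' * (P' * P) = Q' * Q * E"
    by (metis 1(1) 2(1) mult.assoc)
  moreover have "U * U' * (P' * P) + (U * V' * Q + V) * E = U * (U' * P' + V' * E') * P + V * E"
    by (simp add: algebra_simps flip: 1(1))
  hence "U * U' * (P' * P) + (U * V' * Q + V) * E = 1"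
    using 1(2) 2(2) by simp
  ultimately show ?thesis
    unfolding intertwines_def by blast
qed

text \<open>If \<open>P\<close> is injective on the solutions of \<open>E\<close>, then an operator that annihilates the image
  of the solution space has order at least that of \<open>E\<close>.\<close>

lemma op_order_le_of_bezout:
  assumes "U * P + V * E = 1" "R * P = W * E" "R \<noteq> 0"
  shows "op_order E \<le> op_order R"
  using assms
proof (induction "if P = 0 then 0 else Suc (op_order P)" arbitrary: P U V E R W rule: less_induct)
  case less
  show ?case
  proof (cases "P = 0")
    case True
    hence "V * E = 1" using less.prems(1) by simp
    moreover from this have "V \<noteq> 0" "E \<noteq> 0"
      by (metis mult_zero_left zero_neq_one, metis mult_zero_right zero_neq_one)
    ultimately have "op_order V + op_order E = 0"
      by (metis op_order_1 op_order_mult)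
    thus ?thesis by simp
  next
    case False
    then obtain M N where N: "E = M * P + N" "N = 0 \<or> op_order N < op_order P"
      using diffop_right_division by blast
    have W: "W \<noteq> 0" and E: "E \<noteq> 0"
      using less.prems(2,3) False by (metis diffop_mult_eq_0_iff mult_zero_left,
        metis diffop_mult_eq_0_iff mult_zero_right)
    \<comment> \<open>A Euclidean step: the pair (\<open>P\<close>, \<open>E\<close>) becomes
      (\<open>N\<close>, \<open>P\<close>), and \<open>W\<close> takes over the role of
      \<open>R\<close>. Additivity of the order in \<open>R * P = W * E\<close> turns the bound for
      \<open>W\<close> into the one for \<open>R\<close>.\<close>
    have "V * N + (U + V * M) * P = 1"
      using less.prems(1) N(1) by (simp add: algebra_simps)
    moreover have "W * N = (R - W * M) * P"
      using less.prems(2) N(1) by (simp add: algebra_simps)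
    ultimately have "op_order P \<le> op_order W"
      using less.hyps[of N V "U + V * M" P W "R - W * M"] N(2) False W by auto
    moreover have "op_order R + op_order P = op_order W + op_order E"
      using less.prems(2,3) False W E by (metis op_order_mult)
    ultimately show ?thesis by simp
  qed
qed

text \<open>For equal orders the image of \<open>P\<close> is the full solution space of
  \<open>E'\<close>, so whatever annihilates this image is a left multiple of \<open>E'\<close>.
  Formally, the remainder of \<open>X\<close> modulo \<open>E'\<close> is too small in order to be
  non-zero.\<close>

lemma intertwines_right_factor:
  assumes "intertwines P E E'" "op_order E' = op_order E" "E' \<noteq> 0" "X * P = W * E"
  obtains K where "X = K * E'"
proof -
  obtain Q U V where PQ: "E' * P = Q * E" "U * P + V * E = 1"
    using assms(1) by (auto simp: intertwines_def)
  obtain K R where R: "X = K * E' + R" "R = 0 \<or> op_order R < op_order E'"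
    using diffop_right_division[OF assms(3)] by blast
  have "R * P = X * P - K * (E' * P)"
    using R(1) by (simp add: algebra_simps)
  hence "R * P = (W - K * Q) * E"
    using assms(4) PQ(1) by (simp add: algebra_simps)
  hence "R = 0"
    using op_order_le_of_bezout[OF PQ(2)] R(2) assms(2) by (metis not_le)
  thus thesis using that R(1) by simp
qed

text \<open>The Bezout cofactor \<open>U\<close> inverts \<open>P\<close> on solutions: both
  \<open>E * U\<close> and \<open>1 - P * U\<close> vanish on the image of \<open>P\<close>, hence
  are left multiples of \<open>E'\<close>.\<close>

lemma intertwines_inverse:
  assumes "intertwines P E E'" "op_order E' = op_order E" "E' \<noteq> 0"
  shows "\<exists>P'. intertwines P' E' E"
proof -
  obtain Q U V where PQ: "E' * P = Q * E" "U * P + V * E = 1"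
    using assms(1) by (auto simp: intertwines_def)
  have UP: "U * P = 1 - V * E"
    using PQ(2) by (simp add: algebra_simps)
  have "E * U * P = (1 - E * V) * E"
    by (simp add: mult.assoc UP) (simp add: algebra_simps)
  then obtain K where K: "E * U = K * E'"
    using intertwines_right_factor[OF assms] by blast
  have "(1 - P * U) * P = P - P * (U * P)"
    by (simp add: algebra_simps)
  hence "(1 - P * U) * P = P * V * E"
    by (simp add: UP algebra_simps)
  then obtain L where "1 - P * U = L * E'"
    using intertwines_right_factor[OF assms] by blast
  hence "P * U + L * E' = 1"
    by (simp add: algebra_simps)
  thus ?thesis
    using K unfolding intertwines_def by blast
qed

text \<open>Modulo \<open>E\<close>, \<open>T\<close> has a left inverse and equals
  \<open>U * P\<close>; hence \<open>P\<close> has a left inverse too. The target of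
  \<open>T\<close> may differ from that of \<open>P\<close>.\<close>

lemma intertwines_of_bezout:
  assumes "E' * P = Q * E" "U * P + V * E = T" "intertwines T E E''"
  shows "intertwines P E E'"
proof -
  obtain U' V' where "U' * T + V' * E = 1"
    using assms(3) by (auto simp: intertwines_def)
  moreover have "U' * U * P + (U' * V + V') * E = U' * (U * P + V * E) + V' * E"
    by (simp add: algebra_simps)
  ultimately have "U' * U * P + (U' * V + V') * E = 1"
    using assms(2) by simp
  thus ?thesis
    using assms(1) unfolding intertwines_def by blast
qed

text \<open>Reducing \<open>P\<close> modulo \<open>E\<close> does not change its action on
  solutions. The remainder is non-zero, since otherwise \<open>E\<close> would be a unit,
  contradicting its positive order.\<close>

lemma intertwines_shift_operator:
  assumes "intertwines P E E'" "op_order E > 0"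
  shows "\<exists>P. shift_operator E E' P"
proof -
  obtain Q U V where PQ: "E' * P = Q * E" "U * P + V * E = 1"
    using assms(1) by (auto simp: intertwines_def)
  have "E \<noteq> 0"
    using assms(2) by (auto simp: op_order.rep_eq zero_diffop.rep_eq)
  then obtain K R where R: "P = K * E + R" "R = 0 \<or> op_order R < op_order E"
    using diffop_right_division by blast
  have "R \<noteq> 0"
  proof
    assume "R = 0"
    hence 1: "(U * K + V) * E = 1"
      using PQ(2) R(1) by (simp add: algebra_simps)
    hence "U * K + V \<noteq> 0"
      by (metis mult_zero_left zero_neq_one)
    hence "op_order (U * K + V) + op_order E = 0"
      using 1 \<open>E \<noteq> 0\<close> by (metis op_order_1 op_order_mult)
    thus False using assms(2) by simp
  qed
  moreover have "E' * R = (Q - E' * K) * E"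
    using PQ(1) R(1) by (simp add: algebra_simps)
  ultimately show ?thesis
    using R(2) unfolding shift_operator_def by blast
qed

subsection \<open>Laurent polynomials in \<open>x\<close> with coefficients in \<open>\<complex>[\<theta>]\<close>\<close>

definition theta_poly :: "complex poly \<Rightarrow> diffop" where
  "theta_poly f = fold_coeffs (\<lambda>c A. const_op c + theta_op * A) f 0"

lemma theta_poly_0 [simp]: "theta_poly 0 = 0"
  by (simp add: theta_poly_def)

lemma theta_poly_pCons [simp]: "theta_poly (pCons c f) = const_op c + theta_op * theta_poly f"
  by (cases "c = 0 \<and> f = 0") (auto simp: theta_poly_def const_op_0)

lemma theta_poly_add: "theta_poly (f + g) = theta_poly f + theta_poly g"
  by (induction f g rule: poly_induct2) (simp_all add: const_op_add algebra_simps)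

lemma const_op_mult: "const_op (c * d) = const_op c * const_op d"
  by (simp add: const_op_def mult.commute flip: fun_op_mult to_fract_mult)

lemma theta_poly_smult: "theta_poly (smult c f) = const_op c * theta_poly f"
proof (induction f)
  case (pCons d f)
  have "theta_op * (const_op c * theta_poly f) = const_op c * (theta_op * theta_poly f)"
    by (metis mult.assoc theta_op_const_op)
  thus ?case using pCons by (simp add: const_op_mult algebra_simps)
qed simp

lemma theta_poly_mult: "theta_poly (f * g) = theta_poly f * theta_poly g"
  by (induction f) (simp_all add: theta_poly_add theta_poly_smult const_op_0 algebra_simps)

lemma theta_poly_linear: "theta_op + const_op c = theta_poly [:c, 1:]"
  by (simp add: const_op_1)

definition x_inv_op :: diffop where
  "x_inv_op = fun_op (inverse (to_fract [:0, 1:]))"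

lemma x_op_inverse [simp]: "x_op * x_inv_op = 1" "x_inv_op * x_op = 1"
  by (simp_all add: x_op_def x_inv_op_def flip: fun_op_mult)

lemma D_op_eq: "D_op = x_inv_op * theta_op"
  by (simp add: theta_op_def flip: mult.assoc)

lemma theta_poly_x_op: "theta_poly f * x_op = x_op * theta_poly (pcompose f [:1, 1:])"
proof (induction f)
  case (pCons c f)
  have "theta_op * (x_op * A) = x_op * (A + theta_op * A)" for A
    using arg_cong[OF theta_op_shift_x[of 0], of "\<lambda>B. B * A"]
    by (simp add: const_op_0 const_op_1 algebra_simps)
  thus ?case using pCons
    by (simp add: pcompose_pCons theta_poly_add theta_poly_mult const_op_0 const_op_1 x_op_const_op algebra_simps)
qed simp

lemma theta_poly_x_inv_op: "theta_poly f * x_inv_op = x_inv_op * theta_poly (pcompose f [:-1, 1:])"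
proof -
  have "pcompose (pcompose f [:-1, 1:]) [:1, 1:] = f"
    by (simp add: pcompose_pCons pcompose_idR flip: pcompose_assoc)
  hence "theta_poly (pcompose f [:-1, 1:]) * x_op = x_op * theta_poly f"
    by (simp add: theta_poly_x_op)
  hence "x_inv_op * (theta_poly (pcompose f [:-1, 1:]) * x_op) * x_inv_op
      = x_inv_op * (x_op * theta_poly f) * x_inv_op"
    by simp
  thus ?thesis
    by (simp add: mult.assoc) (simp flip: mult.assoc)
qed

text \<open>The list \<open>[f\<^sub>0, f\<^sub>1, \<dots>]\<close> stands for \<open>\<Sum>j. x^-j f\<^sub>j(\<theta>)\<close>.\<close>

fun laurent_op :: "complex poly list \<Rightarrow> diffop" where
  "laurent_op [] = 0"
| "laurent_op (f # fs) = theta_poly f + x_inv_op * laurent_op fs"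

fun laurent_add :: "complex poly list \<Rightarrow> complex poly list \<Rightarrow> complex poly list" where
  "laurent_add [] gs = gs"
| "laurent_add (f # fs) [] = f # fs"
| "laurent_add (f # fs) (g # gs) = (f + g) # laurent_add fs gs"

text \<open>This encodes f(\<theta>) x^-1 = x^-1 f(\<theta> - 1).\<close>

fun laurent_scale :: "complex poly \<Rightarrow> complex poly list \<Rightarrow> complex poly list" where
  "laurent_scale f [] = []"
| "laurent_scale f (g # gs) = f * g # laurent_scale (pcompose f [:-1, 1:]) gs"

fun laurent_mult :: "complex poly list \<Rightarrow> complex poly list \<Rightarrow> complex poly list" where
  "laurent_mult [] gs = []"
| "laurent_mult (f # fs) gs = laurent_add (laurent_scale f gs) (0 # laurent_mult fs gs)"

lemma laurent_op_add: "laurent_op (laurent_add fs gs) = laurent_op fs + laurent_op gs"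
  by (induction fs gs rule: laurent_add.induct) (simp_all add: theta_poly_add algebra_simps)

lemma laurent_op_scale: "laurent_op (laurent_scale f gs) = theta_poly f * laurent_op gs"
proof (induction f gs rule: laurent_scale.induct)
  case (2 f g gs)
  have "theta_poly f * (x_inv_op * A) = x_inv_op * (theta_poly (pcompose f [:-1, 1:]) * A)" for A
    by (metis mult.assoc theta_poly_x_inv_op)
  thus ?case using 2 by (simp add: theta_poly_mult algebra_simps)
qed simp

lemma laurent_op_mult: "laurent_op (laurent_mult fs gs) = laurent_op fs * laurent_op gs"
  by (induction fs) (simp_all add: laurent_op_add laurent_op_scale algebra_simps)

text \<open>The lists hold no positive powers of x; these stay as factors \<open>x_op\<close>, which
  this rule collects on the left.\<close>

lemma laurent_op_x_op:
  "laurent_op fs * x_op = x_op * laurent_op (map (\<lambda>f. pcompose f [:1, 1:]) fs)"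
proof (induction fs)
  case (Cons f fs)
  have "x_inv_op * (x_op * A) = x_op * (x_inv_op * A)" for A
    by (metis mult.assoc x_op_inverse)
  thus ?case using Cons by (simp add: theta_poly_x_op algebra_simps)
qed simp

lemma laurent_op_x_op_mult:
  "laurent_op fs * (x_op * A) = x_op * (laurent_op (map (\<lambda>f. pcompose f [:1, 1:]) fs) * A)"
  by (metis laurent_op_x_op mult.assoc)

text \<open>Reduces an operator identity to polynomial identities in a number \<open>t\<close>.
  Lists must have equal length, which explains the zeros padding several right-hand sides
  below.\<close>

lemma laurent_op_eqI:
  assumes "length fs = length gs" "\<And>t. map (\<lambda>f. poly f t) fs = map (\<lambda>g. poly g t) gs"
  shows "laurent_op fs = laurent_op gs"
proof -
  have "poly (fs ! i) t = poly (gs ! i) t" if "i < length fs" for i t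
    using arg_cong[OF assms(2)[of t], of "\<lambda>xs. xs ! i"] that assms(1) by simp
  hence "fs ! i = gs ! i" if "i < length fs" for i
    using that by (simp add: poly_eq_poly_eq_iff[symmetric] fun_eq_iff)
  thus ?thesis
    using assms(1) nth_equalityI by metis
qed

subsection \<open>The operator \<open>SE\<^sub>5\<close> in adapted parameters\<close>

text \<open>Conjugation by a formal power of \<open>\<partial>\<close> turns \<open>SE\<^sub>5\<close> into an operator of order three, and undoing
  it produces the factors \<open>\<theta> + s + k\<close>. Only what remains without these factors is listed as an argument
  of \<open>twisted_op\<close>, and likewise of \<open>P1_op\<close> and \<open>P2_op\<close> below; the intertwining relations then
  become identities that do not involve \<open>s\<close>.\<close>

definition twisted_op :: "complex \<Rightarrow> complex poly \<Rightarrow> complex poly \<Rightarrow> complex poly \<Rightarrow> complex poly \<Rightarrow> diffop" where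
  "twisted_op s a b1 b2 y = x_op * laurent_op
     [[:s + 1, 1:] * [:s + 2, 1:] * [:s + 3, 1:] * a, [:s + 1, 1:] * [:s + 2, 1:] * b1,
      [:s + 1, 1:] * [:0, 1:] * b2, [:0, 1:] * [:-1, 1:] * y]"

text \<open>The four polynomials are twice (\<theta> + e7 + 1)(\<theta> + e8 + 1), B1(\<theta>),
  B2(\<theta> - 1) and -(\<theta> + 1 - e1)(\<theta> + 1 - e2)(\<theta> + 1 - e3), with e9 = 0. The
  new parameters are u = a+c+1, v = b+c+1, w = a+b+1, h = 2b+q, and n stands for v(v+g).\<close>

definition a_poly :: "complex \<Rightarrow> complex \<Rightarrow> complex poly" where
  "a_poly w g = [:2:] * [:2*w + g + 1, 1:] * [:w + 1, 1:]"

definition b1_poly :: "complex \<Rightarrow> complex \<Rightarrow> complex \<Rightarrow> complex \<Rightarrow> complex \<Rightarrow> complex poly" where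
  "b1_poly u n w g h =
     [: - (5 + 2*h + 6*g + 2*g*h + g^2 + 14*w + 6*w*h + 7*w*g + 2*w*g*h + w*g^2 + 7*w^2 + 4*w^2*h
           + w^2*g - 2*w^3 + n * (1 + g + 2*w) + 2*u + u*g - u*g^2 + 6*u*w + 4*u*w^2
           - u^2 * (1 + g + 2*w)),
        - (2 * (8 + 3*h + 7*g + 2*g*h + g^2 + 15*w + 6*w*h + 4*w*g + w^2 + n
           + 3*u + u*g + 6*u*w - u^2)),
        - (2 * (9 + 3*h + 4*g + 6*w + 3*u)),
        - 6 :]"

definition b2_poly :: "complex \<Rightarrow> complex \<Rightarrow> complex \<Rightarrow> complex \<Rightarrow> complex \<Rightarrow> complex poly" where
  "b2_poly u n w g h = pcompose
     [: 43 + 32*h + 6*h^2 + 34*g + 18*g*h + 2*g*h^2 + 7*g^2 + 2*g^2*h + 38*w + 30*w*h + 6*w*h^2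
         + 15*w*g + 6*w*g*h + w*g^2 - w^2 * (5 + 2*h + g) + n * (5 + 2*h + g + 2*u)
         + 32*u + 12*u*h + 11*u*g + 2*u*g*h - u*g^2 + 30*u*w + 12*u*w*h + 4*u*w*g - 2*u*w^2
         - u^2 - 2*u^2*h - 3*u^2*g + 4*u^2*w - 2*u^3,
        2 * (35 + 21*h + 3*h^2 + 19*g + 6*g*h + 2*g^2 + 15*w + 6*w*h + 3*w*g - w^2 + n
         + 21*u + 6*u*h + 4*u*g + 6*u*w + u^2),
        2 * (18 + 6*h + 5*g + 3*w + 6*u),
        6 :] [:-1, 1:]"

definition y_poly :: "complex \<Rightarrow> complex \<Rightarrow> complex \<Rightarrow> complex poly" where
  "y_poly u g h = [:-2:] * [:1 + h + 2*u + g, 1:] * [:1 + h + u + g, 1:] * [:1 + h, 1:]"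

text \<open>This is \<open>2 SE\<^sub>5\<close>; the factor avoids denominators. Apart from \<open>s\<close>, the operator depends on
  \<open>e\<^sub>4, e\<^sub>5, e\<^sub>6\<close> only through their differences \<open>v, v + g\<close>, and these enter as \<open>v (v + g)\<close>.\<close>

definition Eop :: "complex \<Rightarrow> complex \<Rightarrow> complex \<Rightarrow> complex \<Rightarrow> complex \<Rightarrow> complex \<Rightarrow> diffop" where
  "Eop u v w g h s = twisted_op s (a_poly w g) (b1_poly u (v * (v + g)) w g h)
     (b2_poly u (v * (v + g)) w g h) (y_poly u g h)"

lemma theta_poly_D_op: "theta_poly f * D_op = x_inv_op * theta_poly ([:0, 1:] * pcompose f [:-1, 1:])"
proof -
  have "theta_poly f * D_op = (theta_poly f * x_inv_op) * theta_op"
    by (simp add: D_op_eq mult.assoc)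
  also have "\<dots> = x_inv_op * theta_poly (pcompose f [:-1, 1:] * [:0, 1:])"
    by (simp only: theta_poly_x_inv_op mult.assoc theta_poly_mult)
      (simp add: const_op_0 const_op_1)
  finally show ?thesis by (simp only: mult.commute)
qed

lemma theta_poly_uminus: "theta_poly (- f) = - theta_poly f"
  using theta_poly_add[of f "- f"] by (simp add: eq_neg_iff_add_eq_0 add.commute)

lemma theta_poly_cubic:
  "const_op c * theta_op^3 + const_op d * theta_op^2 + const_op e * theta_op + const_op f
     = theta_poly [:f, e, d, c:]"
proof -
  have "theta_op * (const_op c * A) = const_op c * (theta_op * A)" for A c
    by (metis mult.assoc theta_op_const_op)
  thus ?thesis
    by (simp add: theta_op_const_op distrib_left power2_eq_square power3_eq_cube mult.assoc)
qed

text \<open>Each \<partial> is written as x^-1 \<theta>, and all powers of x are moved to the left;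
  this shifts the arguments of B2 and of T3.\<close>

lemma E5_eq_laurent:
  fixes e :: "nat \<Rightarrow> complex"
  defines "e' \<equiv> e(9 := 0)"
  shows "E5 e = x_op * laurent_op
     [[:es e' + 1, 1:] * [:es e' + 2, 1:] * [:es e' + 3, 1:] * [:e 7 + 1, 1:] * [:e 8 + 1, 1:],
      [:es e' + 1, 1:] * [:es e' + 2, 1:] * [:T10 e', T11 e', T12 e', T13:],
      [:es e' + 1, 1:] * [:0, 1:] * pcompose [:T20 e', T21 e', T22 e', T23:] [:-1, 1:],
      - [:0, 1:] * [:-1, 1:] * [:1 - e 1, 1:] * [:1 - e 2, 1:] * [:1 - e 3, 1:]]"
proof -
  define s where "s = es e'"
  have T3: "T3 e' = theta_poly (- ([:3 - e 1, 1:] * [:3 - e 2, 1:] * [:3 - e 3, 1:]))"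
    by (simp only: T3_def theta_poly_uminus theta_poly_mult theta_poly_linear)
      (simp add: e'_def del: One_nat_def)
  have shift: "pcompose [:c, 1:] [:-1, 1:] = [:c - 1, 1 :: complex:]" for c
    by (simp add: pcompose_pCons)
  have e78: "e' 7 = e 7" "e' 8 = e 8"
    by (simp_all add: e'_def)
  have "x_op * (x_inv_op * A) = A" for A
    by (simp flip: mult.assoc)
  moreover have "E5 e = x_op * theta_poly ([:s + 1, 1:] * [:s + 2, 1:] * [:s + 3, 1:] * [:e 7 + 1, 1:] * [:e 8 + 1, 1:])
      + theta_poly ([:s + 1, 1:] * [:s + 2, 1:] * [:T10 e', T11 e', T12 e', T13:])
      + theta_poly ([:s + 2, 1:] * [:T20 e', T21 e', T22 e', T23:]) * D_op
      + T3 e' * D_op * D_op"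
    unfolding E5_def Let_def e'_def[symmetric] s_def[symmetric] B1_def B2_def theta_poly_cubic
      theta_poly_linear theta_poly_mult mult.assoc power2_eq_square[of D_op] e78 ..
  moreover have "T3 e' * D_op * D_op = x_inv_op * (x_inv_op * theta_poly (- [:0, 1:] * [:-1, 1:] * [:1 - e 1, 1:] * [:1 - e 2, 1:] * [:1 - e 3, 1:]))"
    by (simp only: T3 theta_poly_D_op mult.assoc pcompose_mult pcompose_uminus shift)
      (simp add: mult.assoc algebra_simps)
  moreover have "theta_poly ([:s + 2, 1:] * [:T20 e', T21 e', T22 e', T23:]) * D_op
     = x_inv_op * theta_poly ([:s + 1, 1:] * [:0, 1:] * pcompose [:T20 e', T21 e', T22 e', T23:] [:-1, 1:])"
    by (simp only: theta_poly_D_op pcompose_mult shift) (simp add: ac_simps)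
  ultimately show ?thesis
    unfolding s_def[symmetric] by (simp only: laurent_op.simps distrib_left mult_zero_right add_0_right)
      (simp add: add.assoc)
qed

lemma sum_1_9: "(\<Sum>i=1..9. e i) = e 1 + e 2 + e 3 + e 4 + e 5 + e 6 + e 7 + e 8 + (e 9 :: complex)"
  for e :: "nat \<Rightarrow> complex"
  by (simp add: numeral_eq_Suc)

lemma const_op_laurent_op: "const_op k * laurent_op fs = laurent_op (map (smult k) fs)"
proof (induction fs)
  case (Cons f fs)
  have "const_op k * (x_inv_op * A) = x_inv_op * (const_op k * A)" for A
    using theta_poly_x_inv_op[of "[:k:]"] by (simp add: const_op_0 flip: mult.assoc)
  thus ?case using Cons by (simp add: theta_poly_smult distrib_left)
qed (simp_all add: const_op_0)

lemma Eop_eq_SE5: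
  "Eop (a + c + 1) (b + c + 1) (a + b + 1) g (2*b + q) (2*a + 2*b + 2*c + g + p + q + 3)
     = const_op 2 * SE5 a b c g p q"
proof -
  define s where "s = 2*a + 2*b + 2*c + g + p + q + 3"
  define u where "u = a + c + 1"
  define v where "v = b + c + 1"
  define w where "w = a + b + 1"
  define h where "h = 2*b + q"
  \<comment> \<open>\<open>k\<close> is e6. It cancels from all the coefficients \<open>T10\<close>
    to \<open>T22\<close> below.\<close>
  define k where "k = - 2*a - p"
  define e where "e = (\<lambda>i :: nat.
     [ - 2*a - 2*b - 2*c - g - q - 2,
       - a - c - 2*b - g - q - 1,
       - 2*b - q,
       - 2*a - 2*b - 2*c - g - p - 2,
       - b - c - 2*a - g - p - 1,
       - 2*a - p,
       2*a + 2*b + g + 2,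
       a + b + 1 ] ! (i - 1))"
  have e: "e 1 = - h - 2*u - g" "e 2 = - h - u - g" "e 3 = - h" "e 4 = k - 2*v - g"
    "e 5 = k - v - g" "e 6 = k" "e 7 = 2*w + g" "e 8 = w"
    by (simp_all del: One_nat_def add: e_def h_def u_def v_def k_def w_def)
  define e' where "e' = e(9 := 0)"
  have e': "e' 1 = - h - 2*u - g" "e' 2 = - h - u - g" "e' 3 = - h" "e' 4 = k - 2*v - g"
    "e' 5 = k - v - g" "e' 6 = k" "e' 7 = 2*w + g" "e' 8 = w" "e' 9 = 0"
    by (simp_all add: e'_def e del: One_nat_def)
  have es: "es e' = s"
    unfolding es_def sum_1_9 e' by (simp add: s_def u_def v_def w_def h_def k_def)
  have s1: "s11 e' = - 3*h - 3*u - 2*g" "s12 e' = 3*k - 3*v - 2*g" "s13 e' = 3*w + g"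
    by (simp_all only: s11_def s12_def s13_def e', algebra+)
  have s2: "s21 e' = 3*h^2 + 6*h*u + 4*h*g + 2*u^2 + 3*u*g + g^2"
    "s22 e' = 3*k^2 - 6*k*v - 4*k*g + 2*v^2 + 3*v*g + g^2" "s23 e' = w * (2*w + g)"
    by (simp_all only: s21_def s22_def s23_def e', algebra+)
  have s3: "s31 e' = - h * (h + u + g) * (h + 2*u + g)" "s32 e' = k * (k - 2*v - g) * (k - v - g)"
    "s33 e' = 0"
    by (simp_all only: s31_def s32_def s33_def e', algebra+)
  have T12: "T12 e' = - (9 + 3*h + 4*g + 6*w + 3*u)"
    by (simp only: T12_def s1, algebra)
  have T22: "T22 e' = 18 + 6*h + 5*g + 3*w + 6*u"
    by (simp only: T22_def s1, algebra)
  have T11: "T11 e' = - (8 + 3*h + 7*g + 2*g*h + g^2 + 15*w + 6*w*h + 4*w*g + w^2 + v * (v + g)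
      + 3*u + u*g + 6*u*w - u^2)"
    by (simp only: T11_def s1 s2, algebra)
  have T21: "T21 e' = 35 + 21*h + 3*h^2 + 19*g + 6*g*h + 2*g^2 + 15*w + 6*w*h + 3*w*g - w^2
      + v * (v + g) + 21*u + 6*u*h + 4*u*g + 6*u*w + u^2"
    by (simp only: T21_def s1 s2, algebra)
  have T10: "T10 e' = - (5 + 2*h + 6*g + 2*g*h + g^2 + 14*w + 6*w*h + 7*w*g + 2*w*g*h + w*g^2 + 7*w^2 + 4*w^2*h
           + w^2*g - 2*w^3 + v * (v + g) * (1 + g + 2*w) + 2*u + u*g - u*g^2 + 6*u*w + 4*u*w^2
           - u^2 * (1 + g + 2*w)) / 2"
    by (simp only: T10_def s1 s2 s3, algebra)
  have T20: "T20 e' = (43 + 32*h + 6*h^2 + 34*g + 18*g*h + 2*g*h^2 + 7*g^2 + 2*g^2*h + 38*w + 30*w*h + 6*w*h^2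
         + 15*w*g + 6*w*g*h + w*g^2 - w^2 * (5 + 2*h + g) + v * (v + g) * (5 + 2*h + g + 2*u)
         + 32*u + 12*u*h + 11*u*g + 2*u*g*h - u*g^2 + 30*u*w + 12*u*w*h + 4*u*w*g - 2*u*w^2
         - u^2 - 2*u^2*h - 3*u^2*g + 4*u^2*w - 2*u^3) / 2" (is "_ = ?T20")
  proof -
    \<comment> \<open>The factor 54 clears the denominator 27 of \<open>T20\<close> and the
      denominator 2 of \<open>T10\<close>.\<close>
    have "54 * T20 e' = - 54 * T10 e' + 1026
      + 6 * ((s11 e')^2 * s13 e' - s11 e' * (s12 e')^2 + s11 e' * (s13 e')^2 - (s12 e')^2 * s13 e')
      + 2 * ((s13 e')^3 + (s11 e')^3 - 2 * (s12 e')^3)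
      + 18 * (- 2 * (s11 e')^2 - 4 * s11 e' * s13 e' + s11 e' * s22 e' + 2 * (s12 e')^2 + s22 e' * s12 e'
        - 2 * (s13 e')^2 + s22 e' * s13 e')
      - 270 * s11 e' + 216 * s13 e' + 162 * s21 e' - 108 * s22 e' - 54 * s31 e' - 54 * s32 e' - 54 * s33 e'"
      unfolding T20_def by (simp add: field_simps)
    hence "54 * T20 e' = 54 * ?T20"
      unfolding T10 s1 s2 s3 by algebra
    thus ?thesis by (simp only: mult_cancel_left) simp
  qed
  have e_diff: "1 - (- h - 2*u - g) = 1 + h + 2*u + g" "1 - (- h - u - g) = 1 + h + u + g" "1 - - h = 1 + h"
    by simp_all
  have SE5: "SE5 a b c g p q = E5 e"
    unfolding SE5_def e_def ..
  have double: "smult 2 [:- x / 2, - y, - z, - 3:] = [:- x, - (2 * y), - (2 * z), - 6:]"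
    "smult 2 [:x / 2, y, z, 3:] = [:x, 2 * y, 2 * z, 6:]" for x y z :: complex
    by simp_all
  have "const_op 2 * E5 e = x_op * (const_op 2 * laurent_op
     [[:s + 1, 1:] * [:s + 2, 1:] * [:s + 3, 1:] * [:2*w + g + 1, 1:] * [:w + 1, 1:],
      [:s + 1, 1:] * [:s + 2, 1:] * [:T10 e', T11 e', T12 e', T13:],
      [:s + 1, 1:] * [:0, 1:] * pcompose [:T20 e', T21 e', T22 e', T23:] [:-1, 1:],
      - [:0, 1:] * [:-1, 1:] * [:1 + h + 2*u + g, 1:] * [:1 + h + u + g, 1:] * [:1 + h, 1:]])"
    unfolding E5_eq_laurent e'_def[symmetric] es e e_diff
    by (simp only: mult.assoc[symmetric] x_op_const_op)
  also have "\<dots> = x_op * laurent_op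
     [[:s + 1, 1:] * [:s + 2, 1:] * [:s + 3, 1:] * ([:2:] * [:2*w + g + 1, 1:] * [:w + 1, 1:]),
      [:s + 1, 1:] * [:s + 2, 1:] * smult 2 [:T10 e', T11 e', T12 e', T13:],
      [:s + 1, 1:] * [:0, 1:] * pcompose (smult 2 [:T20 e', T21 e', T22 e', T23:]) [:-1, 1:],
      [:0, 1:] * [:-1, 1:] * ([:-2:] * [:1 + h + 2*u + g, 1:] * [:1 + h + u + g, 1:] * [:1 + h, 1:])]"
  proof -
    have "[:2:] = smult 2 (1 :: complex poly)" "[:-2:] = - smult 2 (1 :: complex poly)"
      by (simp_all add: one_pCons)
    thus ?thesis
      unfolding const_op_laurent_op by (simp only: list.map mult_smult_left mult_smult_right
        pcompose_smult mult_minus_left mult_minus_right mult_1_left mult_1_right smult_minus_right mult.assoc)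
  qed
  also have "\<dots> = Eop u v w g h s"
    unfolding Eop_def twisted_op_def a_poly_def b1_poly_def b2_poly_def y_poly_def
      T10 T11 T12 T13_def T20 T21 T22 T23_def double ..
  finally show ?thesis
    unfolding SE5 by (simp only: s_def u_def v_def w_def h_def)
qed

subsection \<open>Intertwining operators\<close>

text \<open>The right-hand side is k x^-2, which is invertible.\<close>

lemma intertwines_of_unit:
  assumes "E' * P = Q * E" "U * P + V * E = x_op * laurent_op [0, 0, 0, [:k:]]" "k \<noteq> 0"
  shows "intertwines P E E'"
proof -
  have "const_op (inverse k) * (const_op k * A) = A" for A
    using assms(3) by (simp add: const_op_1 flip: mult.assoc const_op_mult)
  moreover have "x_op * (x_inv_op * A) = A" for A
    by (simp flip: mult.assoc)
  moreover have "x_inv_op * const_op k = const_op k * x_inv_op"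
    using theta_poly_x_inv_op[of "[:k:]"] by (simp add: const_op_0)
  moreover have "x_op * (const_op k * A) = const_op k * (x_op * A)" for A
    by (metis mult.assoc x_op_const_op)
  ultimately have "const_op (inverse k) * (x_op * (x_op * (x_op * laurent_op [0, 0, 0, [:k:]]))) = 1"
    using assms(3) by (simp add: const_op_0 const_op_1 flip: const_op_mult)
  hence "const_op (inverse k) * x_op * x_op * (U * P + V * E) = 1"
    unfolding assms(2) by (simp add: mult.assoc)
  hence "(const_op (inverse k) * x_op * x_op * U) * P
      + (const_op (inverse k) * x_op * x_op * V) * E = 1"
    by (simp add: distrib_left mult.assoc)
  thus ?thesis using assms(1) unfolding intertwines_def by blast
qed

section \<open>Coefficient comparison for products with \<open>twisted_op\<close>\<close>

lemma x_laurent_op_eqI: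
  assumes "length fs = length gs" "\<And>t. map (\<lambda>f. poly f t) fs = map (\<lambda>g. poly g t) gs"
  shows "x_op * laurent_op fs = x_op * laurent_op gs"
  using laurent_op_eqI[OF assms] by simp

lemmas laurent_list_simps = laurent_mult.simps laurent_add.simps laurent_scale.simps list.map
  laurent_op_x_op_mult laurent_op_add[symmetric] laurent_op_mult[symmetric]
  mult.assoc[of x_op] distrib_left[of x_op, symmetric]

text \<open>Normal forms for the arguments produced by repeated shifts of \<theta>, so that equal
  values become syntactically equal.\<close>

lemma poly_shift_arg:
  fixes t :: complex
  shows "1 + (- 1 + t) = t" "- 1 + (1 + t) = t" "1 + t = t + 1" "- 1 + t = t - 1"
    "- 1 + (t - 1) = t - 2" "- 1 + (t - 2) = t - 3" "1 + (t - 1) = t" "- 1 + (t + 1) = t"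
    "t - 1 + 1 = t" "t + 1 - 1 = t" "t - 1 - 1 = t - 2" "t - 2 - 1 = t - 3"
    "1 + (t - 2) = t - 1" "1 + (t + 1) = t + 2"
    "t - 2 + 1 = t - 1" "t - 3 + 1 = t - 2" "1 + (t - 3) = t - 2" "- 1 + (t - 3) = t - 4" "t - 4 + 1 = t - 3"
  by simp_all

lemmas laurent_poly_simps = list.map list.inject poly_mult poly_add poly_minus poly_pcompose
  poly_pCons poly_0 mult_zero_right add_0_right add_0_left mult_zero_left mult_1_right poly_shift_arg

definition P1_op :: "complex \<Rightarrow> complex poly \<Rightarrow> complex poly \<Rightarrow> complex poly \<Rightarrow> diffop" where
  "P1_op s A B C = x_op * laurent_op
     [[:s + 1, 1:] * [:s + 2, 1:] * A, [:s + 1, 1:] * B, [:0, 1:] * C]"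

definition P2_op :: "complex \<Rightarrow> complex poly \<Rightarrow> complex poly \<Rightarrow> complex poly \<Rightarrow> diffop" where
  "P2_op s A B C = laurent_op
     [[:s + 1, 1:] * [:s + 2, 1:] * A, [:s + 1, 1:] * [:0, 1:] * B, [:0, 1:] * [:-1, 1:] * C]"

text \<open>The hypotheses compare the coefficients of the powers of x. The factors \<theta> + s + i
  are the same on both sides of each comparison, so \<open>s\<close> does not occur in them.\<close>

lemma twisted_op_P1:
  assumes "\<And>t. poly a' (t + 1) * poly A t = poly A' (t + 1) * poly a t"
    and "\<And>t. poly a' t * poly B t + poly b1' (t + 1) * poly A t
           = poly A' t * poly b1 t + poly B' (t + 1) * poly a t"
    and "\<And>t. t * poly a' (t - 1) * poly C t + poly b1' t * poly B t + (t + 1) * poly b2' (t + 1) * poly A t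
           = t * poly A' (t - 1) * poly b2 t + poly B' t * poly b1 t + (t + 1) * poly C' (t + 1) * poly a t"
    and "\<And>t. poly b1' (t - 1) * poly C t + poly b2' t * poly B t + (t + 1) * poly y' (t + 1) * poly A t
           = (t - 1) * poly A' (t - 2) * poly y t + poly B' (t - 1) * poly b2 t + poly C' t * poly b1 t"
    and "\<And>t. poly b2' (t - 1) * poly C t + poly y' t * poly B t
           = poly B' (t - 2) * poly y t + poly C' (t - 1) * poly b2 t"
    and "\<And>t. poly y' (t - 1) * poly C t = poly C' (t - 2) * poly y t"
  shows "twisted_op (s + 1) a' b1' b2' y' * P1_op s A B C = P1_op (s + 2) A' B' C' * twisted_op s a b1 b2 y"
  unfolding twisted_op_def P1_op_def laurent_list_simps
    apply (intro arg_cong[of _ _ "\<lambda>A. x_op * A"] x_laurent_op_eqI, simp, simp only: laurent_poly_simps)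
    subgoal for t
      apply (intro conjI refl)
      subgoal using assms(1)[of t] by algebra
      subgoal using assms(2)[of t] by algebra
      subgoal using assms(3)[of t] by algebra
      subgoal using assms(4)[of t] by algebra
      subgoal using assms(5)[of t] by algebra
      subgoal using assms(6)[of t] by algebra
      done
    done

text \<open>The right-hand side is the shape of a product of three operators \<theta> + s + i or
  \<theta> - \<partial> + s + i. Up to a scalar, (k0, k1, k2) is (1, -2, 1) if two of them contain
  \<partial>, and (1, -1, 0) if one does.\<close>

lemma P1_bezout:
  assumes "\<And>t. poly UA (t + 1) * poly A t + poly V0 (t + 1) * poly a t = 0"
    and "\<And>t. poly UA t * poly B t + (t + 1) * poly UB (t + 1) * poly A t + poly V0 t * poly b1 t
           + (t + 1) * poly V1 (t + 1) * poly a t = k0"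
    and "\<And>t. poly UA (t - 1) * poly C t + poly UB t * poly B t + (t + 1) * poly UC (t + 1) * poly A t
           + poly V0 (t - 1) * poly b2 t + poly V1 t * poly b1 t = k1"
    and "\<And>t. poly UB (t - 1) * poly C t + poly UC t * poly B t + poly V0 (t - 2) * poly y t
           + poly V1 (t - 1) * poly b2 t = k2"
    and "\<And>t. poly UC (t - 1) * poly C t + poly V1 (t - 2) * poly y t = 0"
  shows "P2_op (s + 1) UA UB UC * P1_op s A B C
      + laurent_op [[:s + 3, 1:] * V0, [:0, 1:] * V1] * twisted_op s a b1 b2 y
    = x_op * laurent_op [0, [:s + 1, 1:] * [:s + 2, 1:] * [:s + 3, 1:] * [:k0:],
        [:s + 1, 1:] * [:s + 2, 1:] * [:0, 1:] * [:k1:], [:s + 1, 1:] * [:0, 1:] * [:-1, 1:] * [:k2:], 0]"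
  unfolding twisted_op_def P1_op_def P2_op_def laurent_list_simps
    apply (intro arg_cong[of _ _ "\<lambda>A. x_op * A"] x_laurent_op_eqI, simp, simp only: laurent_poly_simps)
    subgoal for t
      apply (intro conjI refl)
      subgoal using assms(1)[of t] by algebra
      subgoal unfolding assms(2)[of t, symmetric] by algebra
      subgoal unfolding assms(3)[of t, symmetric] by algebra
      subgoal unfolding assms(4)[of t, symmetric] by algebra
      subgoal using assms(5)[of t] by algebra
      done
    done

lemma twisted_op_P2:
  assumes "\<And>t. poly a' t * poly A t = poly A' (t + 1) * poly a t"
    and "\<And>t. t * poly a' (t - 1) * poly B t + poly b1' t * poly A t
           = poly A' t * poly b1 t + (t + 1) * poly B' (t + 1) * poly a t"
    and "\<And>t. (t - 1) * poly a' (t - 2) * poly C t + poly b1' (t - 1) * poly B t + poly b2' t * poly A t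
           = poly A' (t - 1) * poly b2 t + poly B' t * poly b1 t + (t + 1) * poly C' (t + 1) * poly a t"
    and "\<And>t. poly b1' (t - 2) * poly C t + poly b2' (t - 1) * poly B t + poly y' t * poly A t
           = poly A' (t - 2) * poly y t + poly B' (t - 1) * poly b2 t + poly C' t * poly b1 t"
    and "\<And>t. poly b2' (t - 2) * poly C t + poly y' (t - 1) * poly B t
           = poly B' (t - 2) * poly y t + poly C' (t - 1) * poly b2 t"
    and "\<And>t. poly y' (t - 2) * poly C t = poly C' (t - 2) * poly y t"
  shows "twisted_op (s + 2) a' b1' b2' y' * P2_op s A B C = P2_op (s + 2) A' B' C' * twisted_op s a b1 b2 y"
  unfolding twisted_op_def P2_op_def laurent_list_simps
    apply (rule x_laurent_op_eqI, simp, simp only: laurent_poly_simps)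
    subgoal for t
      apply (intro conjI refl)
      subgoal using assms(1)[of t] by algebra
      subgoal using assms(2)[of t] by algebra
      subgoal using assms(3)[of t] by algebra
      subgoal using assms(4)[of t] by algebra
      subgoal using assms(5)[of t] by algebra
      subgoal using assms(6)[of t] by algebra
      done
    done

text \<open>The right-hand side is k (\<theta> + s + 1)(\<theta> + s + 2). Unlike in
  \<open>P1_bezout\<close>, the factors with \<open>s\<close> do not all cancel from the comparison
  of coefficients.\<close>

lemma P2_bezout:
  assumes "\<And>t. poly u2 t * poly A t + poly v1 (t + 1) * poly a t = 0"
    and "\<And>t. t * poly u2 (t - 1) * poly B t + poly u1 t * poly A t + poly v1 t * poly b1 t
           + poly v0 (t + 1) * poly a t = 0"
    and "\<And>t. t * (t - 1) * poly u2 (t - 2) * poly C t + t * poly u1 (t - 1) * poly B t + poly u0 t * poly A t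
           + t * poly v1 (t - 1) * poly b2 t + poly v0 t * poly b1 t
           + (t + 1) * (t + s + 3) * poly vm (t + 1) * poly a t = k"
    and "\<And>t. (t - 1) * poly u1 (t - 2) * poly C t + poly u0 (t - 1) * poly B t + (t + s + 2) * poly um t * poly A t
           + (t - 1) * poly v1 (t - 2) * poly y t + poly v0 (t - 1) * poly b2 t
           + (t + s + 2) * poly vm t * poly b1 t = 0"
    and "\<And>t. poly u0 (t - 2) * poly C t + (t + s + 1) * poly um (t - 1) * poly B t
           + poly v0 (t - 2) * poly y t + (t + s + 1) * poly vm (t - 1) * poly b2 t = 0"
    and "\<And>t. poly um (t - 2) * poly C t + poly vm (t - 2) * poly y t = 0"
  shows "x_op * (x_op * laurent_op [[:s + 3, 1:] * [:s + 4, 1:] * u2, [:s + 3, 1:] * u1, u0, [:0, 1:] * um])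
        * P2_op s A B C
      + x_op * laurent_op [[:s + 3, 1:] * v1, v0, [:0, 1:] * vm] * twisted_op s a b1 b2 y
    = x_op * (x_op * laurent_op [0, 0, [:s + 1, 1:] * [:s + 2, 1:] * [:k:], 0, 0, 0])"
  unfolding twisted_op_def P2_op_def laurent_list_simps
    apply (intro arg_cong[of _ _ "\<lambda>A. x_op * A"] x_laurent_op_eqI, simp, simp only: laurent_poly_simps)
    subgoal for t
      apply (intro conjI refl)
      subgoal using assms(1)[of t] by algebra
      subgoal using assms(2)[of t] by algebra
      subgoal unfolding assms(3)[of t, symmetric] by algebra
      subgoal using assms(4)[of t] by algebra
      subgoal using assms(5)[of t] by algebra
      subgoal using assms(6)[of t] by algebra
      done
    done

lemma x_op_laurent_op_0: "x_op * laurent_op (0 # fs) = laurent_op fs"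
  by (simp flip: mult.assoc)

lemma poly_a_poly: "poly (a_poly w g) t = 2 * (t + 2*w + g + 1) * (t + w + 1)"
  unfolding a_poly_def by (simp only: laurent_poly_simps) algebra

lemma poly_b1_poly:
  "poly (b1_poly u n w g h) t =
     - (5 + 2*h + 6*g + 2*g*h + g^2 + 14*w + 6*w*h + 7*w*g + 2*w*g*h + w*g^2 + 7*w^2 + 4*w^2*h
           + w^2*g - 2*w^3 + n * (1 + g + 2*w) + 2*u + u*g - u*g^2 + 6*u*w + 4*u*w^2
           - u^2 * (1 + g + 2*w))
     - 2*t * (8 + 3*h + 7*g + 2*g*h + g^2 + 15*w + 6*w*h + 4*w*g + w^2 + n + 3*u + u*g + 6*u*w - u^2)
     - 2*t^2 * (9 + 3*h + 4*g + 6*w + 3*u) - 6*t^3"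
  unfolding b1_poly_def by (simp only: laurent_poly_simps) algebra

lemma poly_b2_poly:
  "poly (b2_poly u n w g h) t =
     43 + 32*h + 6*h^2 + 34*g + 18*g*h + 2*g*h^2 + 7*g^2 + 2*g^2*h + 38*w + 30*w*h + 6*w*h^2
         + 15*w*g + 6*w*g*h + w*g^2 - w^2 * (5 + 2*h + g) + n * (5 + 2*h + g + 2*u)
         + 32*u + 12*u*h + 11*u*g + 2*u*g*h - u*g^2 + 30*u*w + 12*u*w*h + 4*u*w*g - 2*u*w^2
         - u^2 - 2*u^2*h - 3*u^2*g + 4*u^2*w - 2*u^3
     + 2*(t - 1) * (35 + 21*h + 3*h^2 + 19*g + 6*g*h + 2*g^2 + 15*w + 6*w*h + 3*w*g - w^2 + n
         + 21*u + 6*u*h + 4*u*g + 6*u*w + u^2)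
     + 2*(t - 1)^2 * (18 + 6*h + 5*g + 3*w + 6*u) + 6*(t - 1)^3"
  unfolding b2_poly_def by (simp only: laurent_poly_simps) algebra

lemma poly_y_poly: "poly (y_poly u g h) t = - 2 * (t + 1 + h + 2*u + g) * (t + 1 + h + u + g) * (t + 1 + h)"
  unfolding y_poly_def by (simp only: laurent_poly_simps) algebra

lemmas poly_Eop = poly_a_poly poly_b1_poly poly_b2_poly poly_y_poly

section \<open>Intertwiners for the generating shifts and the conditions for their
  invertibility\<close>

definition cond_p :: "complex \<Rightarrow> complex \<Rightarrow> complex \<Rightarrow> complex \<Rightarrow> complex" where
  "cond_p u g h s = (s + 1) * (s + 2) * (h - s) * (h + u + g - s) * (h + 2*u + g - s)"

text \<open>In terms of the e's this is (s+1)(s+2)(s+e4)(s+e5)(s+e6), while \<open>cond_p\<close> is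
  -(s+1)(s+2)(s+e1)(s+e2)(s+e3).\<close>

definition cond_q :: "complex \<Rightarrow> complex \<Rightarrow> complex \<Rightarrow> complex \<Rightarrow> complex \<Rightarrow> complex \<Rightarrow> complex" where
  "cond_q u v w g h s = (s + 1) * (s + 2) * (h + u - w + 2) * (h + u - v - w + 2) * (h + u + v + g - w + 2)"

text \<open>This and the next two are, up to sign, the constants in the Bezout relations of the
  other generators.\<close>

definition cond_ag :: "complex \<Rightarrow> complex \<Rightarrow> complex \<Rightarrow> complex \<Rightarrow> complex" where
  "cond_ag u v w g = (g + 1) * (u - v + w - 1) * (u - v - w - g - 1) * (u + v - w + g + 1) * (u + v + w + 2*g + 1)"

definition cond_acg :: "complex \<Rightarrow> complex \<Rightarrow> complex \<Rightarrow> complex \<Rightarrow> complex" where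
  "cond_acg u v w g = (g + 1) * (u - v + w - 1) * (u + v - w - 1) * (u - v - w - g - 1) * (u + v + w + g - 1)"

definition cond_a :: "complex \<Rightarrow> complex \<Rightarrow> complex \<Rightarrow> complex \<Rightarrow> complex \<Rightarrow> complex" where
  "cond_a u v w g s = (s + 3) * (2*w + g + 1) * (u - v + w + 1) * (u - v + w + g + 1) * (u + v + w + g + 1) * (u + v + w + 2*g + 1)"

lemmas cond_defs = cond_p_def cond_q_def cond_ag_def cond_acg_def cond_a_def

text \<open>All coefficients of \<open>Eop\<close> but the last contain \<theta> + s + 1, and the
  last is a constant \<open>k\<close> modulo this factor. Equivalently, \<open>P\<close> annihilates
  x^(-s-1), which \<open>Eop\<close> maps to k x^(-s-3).\<close>

lemma intertwines_p:
  assumes "cond_p u g h s \<noteq> 0"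
  shows "intertwines (laurent_op [[:s + 1, 1:]]) (Eop u v w g h s) (Eop u v w g h (s + 1))"
proof -
  define a b1 b2 y where "a = a_poly w g" and "b1 = b1_poly u (v * (v + g)) w g h"
    and "b2 = b2_poly u (v * (v + g)) w g h" and "y = y_poly u g h"
  define k where "k = (s + 1) * (s + 2) * poly y (- s - 1)"
  have "[:s + 1, 1:] dvd [:0, 1:] * [:-1, 1:] * y - [:k:]"
    using poly_eq_0_iff_dvd[of "[:0, 1:] * [:-1, 1:] * y - [:k:]" "- s - 1"]
    by (simp add: k_def algebra_simps)
  then obtain r where r: "[:0, 1:] * [:-1, 1:] * y - [:k:] = [:s + 1, 1:] * r"
    by (elim dvdE)
  have r': "t * (t - 1) * poly y t - k = (t + s + 1) * poly r t" for t
    using arg_cong[OF r, of "\<lambda>p. poly p t"] by (simp add: algebra_simps)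
  have "twisted_op (s + 1) a b1 b2 y * laurent_op [[:s + 1, 1:]]
      = laurent_op [[:s + 3, 1:]] * twisted_op s a b1 b2 y"
    unfolding twisted_op_def laurent_list_simps
    by (rule x_laurent_op_eqI, simp, simp only: laurent_poly_simps) (intro conjI refl; algebra)
  moreover have "x_op * laurent_op [- [:s + 2, 1:] * [:s + 3, 1:] * a, - [:s + 2, 1:] * b1, - [:0, 1:] * b2, - r]
        * laurent_op [[:s + 1, 1:]] + 1 * twisted_op s a b1 b2 y = x_op * laurent_op [0, 0, 0, [:k:]]"
    unfolding twisted_op_def mult_1 laurent_list_simps
    apply (rule x_laurent_op_eqI, simp, simp only: laurent_poly_simps)
    subgoal for t
      apply (intro conjI refl)
      subgoal by algebra
      subgoal by algebra
      subgoal by algebra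
      subgoal using r'[of t] by algebra
      done
    done
  moreover have "k = - 2 * ((s + 1) * (s + 2) * (h - s) * (h + u + g - s) * (h + 2*u + g - s))"
    unfolding k_def y_def poly_y_poly by algebra
  hence "k \<noteq> 0"
    using assms by (simp only: cond_p_def) simp
  ultimately show ?thesis
    unfolding Eop_def a_def b1_def b2_def y_def by (rule intertwines_of_unit)
qed

text \<open>Analogue of \<open>intertwines_p\<close> at the singular point x = 1: \<open>P\<close>
  is \<theta> - \<partial> + s + 1, which annihilates (x-1)^(-s-1), and \<open>Eop\<close> maps this
  function to k (x-1)^(-s-3).\<close>

lemma intertwines_q:
  assumes "cond_q u v w g h s \<noteq> 0"
  shows "intertwines (laurent_op [[:s + 1, 1:], [:0, -1:]]) (Eop u v w g h s) (Eop u v w g (h + 1) (s + 1))"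
proof -
  define n where "n = v * (v + g)"
  define a b1 b2 y where "a = a_poly w g" and "b1 = b1_poly u n w g h"
    and "b2 = b2_poly u n w g h" and "y = y_poly u g h"
  define b1' b2' y' where "b1' = b1_poly u n w g (h + 1)"
    and "b2' = b2_poly u n w g (h + 1)" and "y' = y_poly u g (h + 1)"
  note defs = a_def b1_def b2_def y_def b1'_def b2'_def y'_def n_def
  define k where "k = - 2 * ((s + 1) * (s + 2) * (h + u - w + 2) * (h + u - v - w + 2) * (h + u + v + g - w + 2))"
  \<comment> \<open>The next four facts are what the intertwining relation requires of the
    coefficients; the fifth is the only non-trivial coefficient of the Bezout relation.\<close>
  have 1: "poly b1' t - t * poly a (t - 1) = poly b1 t - (t + 1) * poly a t" for t
    unfolding defs poly_Eop by algebra
  have 2: "poly b2' t - poly b1' (t - 1) = poly b2 t - poly b1 t" for t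
    unfolding defs poly_Eop by algebra
  have 3: "poly y' t - poly b2' (t - 1) = poly y t - poly b2 t" for t
    unfolding defs poly_Eop by algebra
  have 4: "poly y' (t - 1) = poly y t" for t
    unfolding defs poly_Eop by algebra
  have 5: "((t + s + 2) * (poly y (t + 2) + poly b2 (t + 1)) - 2 * t * poly y (t + 1)) * (t + s + 1)
      + t * ((t - 1) * ((t - 2) * poly a (t - 3) + poly b1 (t - 2) - 2 * (t + s + 1) * poly a (t - 2))
        + (t - 1) * poly b2 (t - 1) - 2 * (t + s + 1) * poly b1 (t - 1) + (t + s + 1) * (t + s + 2) * poly a (t - 1))
      + t * (t - 1) * poly y t - 2 * (t + s + 1) * t * poly b2 t + (t + s + 1) * (t + s + 2) * poly b1 t = k" for t
    unfolding defs k_def poly_Eop by algebra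
  have shift_arg: "- 2 + t = t - 2" "- 2 + (t - 1) = t - 3" "2 + t = t + 2"
    "t - 1 - 2 = t - 3" "2 + (t - 1) = t + 1" "t - 1 + 2 = t + 1" for t :: complex
    by simp_all
  have "twisted_op (s + 1) a b1' b2' y' * laurent_op [[:s + 1, 1:], [:0, -1:]]
      = laurent_op [[:s + 3, 1:], [:0, -1:]] * twisted_op s a b1 b2 y"
    unfolding twisted_op_def laurent_list_simps
    apply (rule x_laurent_op_eqI, simp, simp only: laurent_poly_simps)
    subgoal for t
      apply (intro conjI refl)
      subgoal by algebra
      subgoal using 1[of t] by algebra
      subgoal using 2[of t] by algebra
      subgoal using 3[of t] by algebra
      subgoal unfolding 4[of t] by algebra
      done
    done
  \<comment> \<open>The leading coefficient of \<open>P\<close> is x - 1. The cofactor (1 - 1/x)^2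
    of the equation clears the poles that division by \<open>P\<close> would create.\<close>
  moreover have "x_op * laurent_op
        [- [:s + 2, 1:] * [:s + 3, 1:] * a,
         - [:s + 2, 1:] * ([:0, 1:] * pcompose a [:-1, 1:] + b1 + [:-2:] * [:s + 3, 1:] * a),
         [:0, -1:] * ([:-1, 1:] * pcompose a [:-2, 1:] + pcompose b1 [:-1, 1:]
             + [:-2:] * [:s + 2, 1:] * pcompose a [:-1, 1:] + b2)
           + [:2:] * [:s + 2, 1:] * b1 + [:-1:] * [:s + 2, 1:] * [:s + 3, 1:] * a,
         [:s + 2, 1:] * (pcompose y [:2, 1:] + pcompose b2 [:1, 1:]) + [:0, -2:] * pcompose y [:1, 1:],
         [:0, 1:] * pcompose y [:1, 1:]] * laurent_op [[:s + 1, 1:], [:0, -1:]]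
      + laurent_op [[:1:], [:-2:], [:1:]] * twisted_op s a b1 b2 y
      = x_op * laurent_op [0, 0, 0, [:k:], 0, 0]"
    unfolding twisted_op_def laurent_list_simps
    apply (rule x_laurent_op_eqI, simp, simp only: laurent_poly_simps)
    subgoal for t
      apply (intro conjI refl)
      subgoal by algebra
      subgoal by algebra
      subgoal unfolding shift_arg by algebra
      subgoal unfolding shift_arg 5[of t, symmetric] by algebra
      subgoal unfolding shift_arg by algebra
      subgoal by algebra
      done
    done
  moreover have "laurent_op [0, 0, 0, [:k:], 0, 0] = laurent_op [0, 0, 0, [:k:]]"
    by simp
  moreover have "k \<noteq> 0"
    unfolding k_def using assms unfolding cond_q_def by (metis mult_eq_0_iff neg_equal_0_iff_equal zero_neq_numeral)
  ultimately show ?thesis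
    unfolding Eop_def defs by (metis intertwines_of_unit)
qed

lemma intertwines_scale_left:
  assumes "E' * P = Q * E" "U * P + V * E = const_op k * T" "intertwines T E E''" "k \<noteq> 0"
  shows "intertwines P E E'"
proof -
  have "const_op (inverse k) * (const_op k * T) = T"
    using assms(4) by (simp add: const_op_1 flip: mult.assoc const_op_mult)
  hence "(const_op (inverse k) * U) * P + (const_op (inverse k) * V) * E = T"
    by (simp add: mult.assoc flip: distrib_left assms(2))
  thus ?thesis
    using intertwines_of_bezout assms(1,3) by blast
qed

lemma const_op_laurent_op_3:
  "const_op k * laurent_op [f0, f1, f2] = x_op * laurent_op [0, smult k f0, smult k f1, smult k f2, 0]"
  by (simp add: x_op_laurent_op_0 const_op_laurent_op del: laurent_op.simps) simp

text \<open>This is (a, g, p) \<rightarrow> (a - 1, g + 2, p + 1). The operator \<open>T\<close> of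
  the Bezout relation consists of two steps in q and one in p.\<close>

lemma intertwines_ag:
  assumes "cond_q u v w g h s \<noteq> 0" "cond_q u v w g (h + 1) (s + 1) \<noteq> 0" "cond_p u g (h + 2) (s + 2) \<noteq> 0"
    "cond_ag u v w g \<noteq> 0"
  shows "\<exists>P. intertwines P (Eop u v w g h s) (Eop (u - 1) v (w - 1) (g + 2) h (s + 1))"
proof -
  define R1 R2 R3 where "R1 = laurent_op [[:s + 1, 1:], [:0, -1:]]"
    and "R2 = laurent_op [[:s + 2, 1:], [:0, -1:]]" and "R3 = laurent_op [[:s + 3, 1:]]"
  have "s + 1 + 1 = s + 2" "s + 2 + 1 = s + 3" "h + 1 + 1 = h + 2"
    by simp_all
  hence "intertwines R1 (Eop u v w g h s) (Eop u v w g (h + 1) (s + 1))"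
    "intertwines R2 (Eop u v w g (h + 1) (s + 1)) (Eop u v w g (h + 2) (s + 2))"
    "intertwines R3 (Eop u v w g (h + 2) (s + 2)) (Eop u v w g (h + 2) (s + 3))"
    using intertwines_q[OF assms(1)] intertwines_q[OF assms(2)] intertwines_p[OF assms(3), of v w]
    by (simp_all only: R1_def R2_def R3_def)
  hence R: "intertwines (R3 * (R2 * R1)) (Eop u v w g h s) (Eop u v w g (h + 2) (s + 3))"
    by (blast intro: intertwines_mult)
  define k where "k = cond_ag u v w g"
  define A B C where "A = [:2*w + g + 1, 1:]"
    and "B = [:-2 -h -3*g -g*h -g^2 -3*w -2*w*h +w^2 -v -2*v*g -v^2 -u -2*u*w +u^2, - 2 * (2 + h + g + w + u), -2:]"
    and "C = [:h + 1, 1:] * [:2*u + g + h + 1, 1:]"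
  \<comment> \<open>The first relation of \<open>twisted_op_P1\<close> forces A' = A here.\<close>
  define B' C' where
    "B' = [:-5 -h -6*g -g*h -g^2 -5*w -2*w*h +w^2 -3*v -2*v*g -v^2 -u -2*u*w +u^2, - 2 * (3 + h + g + w + u), -2:]"
    and "C' = [:h + 2, 1:] * [:2*u + g + h + 2, 1:]"
  define V0 V1 where
    "V0 = [:- (3 + 5*g + 2*g^2 + 2*w + 3*w*g + w^2 + 4*v + 3*v*g + 2*v*w + v^2 - u*g - u^2), - (2 * (1 + g + v)):]"
    and "V1 = [:3 + 2*h + 3*g + 2*g*h + w*g + w^2 + 2*v + 2*v*h - v*g - v^2 + 2*u + u*g + 2*u*v - u^2, 2 * (1 + g + v):]"
  \<comment> \<open>The outermost relations of \<open>P1_bezout\<close> determine \<open>UA\<close>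
    from \<open>V0\<close> and \<open>UC\<close> from \<open>V1\<close>. The last factor of
    \<open>UC\<close> is V1(\<theta> - 1).\<close>
  define UA UB UC where "UA = [:-2:] * [:w, 1:] * V0"
    and "UB = [:2:] * [:-h -g -3*g*h -g^2 -2*g^2*h -7*w -4*w*h -11*w*g -5*w*g*h -3*w*g^2 -2*w^2 -w^2*h -2*w^2*g
        -w^3 -2*v*h -3*v*g*h +v*g^2 -6*v*w -4*v*w*h -v*w*g -v^2*h +v^2*g +v^2*w -u -u*g +u*g*h -u*g^2 -4*u*w
        -4*u*w*g -u*w^2 -2*u*v -3*u*v*g -4*u*v*w -u*v^2 +2*u^2 +u^2*h +2*u^2*g +u^2*w +u^3,
        2 * (-4 -2*h -6*g -2*g*h -2*g^2 -2*w -3*w*g -w^2 -4*v -2*v*h -2*v*g -2*v*w -2*u -u*g -2*u*v +u^2),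
        - 4 * (1 + g + v):]"
    and "UC = [:2:] * [:u + g + h + 2, 1:] * (V1 - [:2 * (1 + g + v):])"
  note defs = A_def B_def C_def B'_def C'_def V0_def V1_def UA_def UB_def UC_def
  have "Eop (u - 1) v (w - 1) (g + 2) h (s + 1) * P1_op s A B C = P1_op (s + 2) A B' C' * Eop u v w g h s"
    unfolding Eop_def
    by (rule twisted_op_P1; unfold defs; simp only: laurent_poly_simps poly_Eop; algebra)
  moreover have "P2_op (s + 1) UA UB UC * P1_op s A B C
      + laurent_op [[:s + 3, 1:] * V0, [:0, 1:] * V1] * Eop u v w g h s
    = x_op * laurent_op [0, [:s + 1, 1:] * [:s + 2, 1:] * [:s + 3, 1:] * [:k:],
        [:s + 1, 1:] * [:s + 2, 1:] * [:0, 1:] * [:-2 * k:], [:s + 1, 1:] * [:0, 1:] * [:-1, 1:] * [:k:], 0]"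
    unfolding Eop_def k_def cond_ag_def
    by (rule P1_bezout; unfold defs; simp only: laurent_poly_simps poly_Eop poly_diff; algebra)
  moreover have "x_op * laurent_op [0, [:s + 1, 1:] * [:s + 2, 1:] * [:s + 3, 1:] * [:k:],
        [:s + 1, 1:] * [:s + 2, 1:] * [:0, 1:] * [:-2 * k:], [:s + 1, 1:] * [:0, 1:] * [:-1, 1:] * [:k:], 0]
      = const_op k * (R3 * (R2 * R1))"
    unfolding R1_def R2_def R3_def laurent_op_mult[symmetric] laurent_mult.simps laurent_scale.simps laurent_add.simps
      const_op_laurent_op_3
    by (rule x_laurent_op_eqI, simp, simp only: laurent_poly_simps poly_smult) (intro conjI refl; algebra)
  ultimately show ?thesis
    using R assms(4) intertwines_scale_left k_def by metis
qed

lemma const_op_laurent_op_2: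
  "const_op k * laurent_op [f0, f1] = x_op * laurent_op [0, smult k f0, smult k f1, 0, 0]"
  by (simp add: x_op_laurent_op_0 const_op_laurent_op del: laurent_op.simps) simp

text \<open>This is (a, c, g, p, q) \<rightarrow> (a - 1, c - 1, g + 2, p + 2, q + 1); now
  \<open>T\<close> consists of one step in q and two in p.\<close>

lemma intertwines_acg:
  assumes "cond_q u v w g h s \<noteq> 0" "cond_p u g (h + 1) (s + 1) \<noteq> 0" "cond_p u g (h + 1) (s + 2) \<noteq> 0"
    "cond_acg u v w g \<noteq> 0"
  shows "\<exists>P. intertwines P (Eop u v w g h s) (Eop (u - 2) (v - 1) (w - 1) (g + 2) (h + 1) (s + 1))"
proof -
  define R1 R2 R3 where "R1 = laurent_op [[:s + 1, 1:], [:0, -1:]]"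
    and "R2 = laurent_op [[:s + 2, 1:]]" and "R3 = laurent_op [[:s + 3, 1:]]"
  have "s + 1 + 1 = s + 2" "s + 2 + 1 = s + 3"
    by simp_all
  hence "intertwines R1 (Eop u v w g h s) (Eop u v w g (h + 1) (s + 1))"
    "intertwines R2 (Eop u v w g (h + 1) (s + 1)) (Eop u v w g (h + 1) (s + 2))"
    "intertwines R3 (Eop u v w g (h + 1) (s + 2)) (Eop u v w g (h + 1) (s + 3))"
    using intertwines_q[OF assms(1)] intertwines_p[OF assms(2), of v w] intertwines_p[OF assms(3), of v w]
    by (simp_all only: R1_def R2_def R3_def)
  hence R: "intertwines (R3 * (R2 * R1)) (Eop u v w g h s) (Eop u v w g (h + 1) (s + 3))"
    by (blast intro: intertwines_mult)
  define k where "k = cond_acg u v w g"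
  define A B C where "A = [:2*w + g + 1, 1:]"
    and "B = [:-2 -h -3*g -g*h -g^2 -4*w -2*w*h -w*g +w^2 -v*g -v^2 -2*u -u*g -2*u*w +u^2,
        - (5 + 2*h + 3*g + 2*w + 2*u), -2:]"
    and "C = [:g + h + 2, 1:] * [:2*u + g + h + 1, 1:]"
  define B' C' where
    "B' = [:-1 -h -4*g -g*h -g^2 -6*w -2*w*h -w*g +w^2 -v*g -v^2 -4*u -u*g -2*u*w +u^2,
        - (7 + 2*h + 3*g + 2*w + 2*u), -2:]"
    and "C' = [:g + h + 4, 1:] * [:2*u + g + h + 1, 1:]"
  define V0 V1 where
    "V0 = [:3 + g + 2*w + w*g + w^2 - v*g - v^2 - 4*u - u*g - 2*u*w + u^2, 2 * (1 - u):]"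
    and "V1 = [:2 * (u - 1):] * [:g + h + 4, 1:]"
  define UA UB UC where "UA = [:-2:] * [:w, 1:] * V0"
    and "UB = [:2:] * [:3 +h +3*g +g*h +10*w +4*w*h +3*w*g +w*g*h +w^2 +w^2*h -v*g -v*g*h -v^2 -v^2*h -5*u
        -2*u*h -4*u*g -u*g*h -8*u*w -4*u*w*h -u*w*g +u*w^2 -u*v*g -u*v^2 +u^2 +u^2*h +u^2*g -2*u^2*w +u^3,
        11 +4*h +3*g +4*w +w*g +w^2 -v*g -v^2 -10*u -4*u*h -3*u*g -4*u*w -u^2,
        4 * (1 - u):]"
    and "UC = [:4 * (u - 1):] * [:h + 2, 1:] * [:u + g + h + 2, 1:]"
  note defs = A_def B_def C_def B'_def C'_def V0_def V1_def UA_def UB_def UC_def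
  have "Eop (u - 2) (v - 1) (w - 1) (g + 2) (h + 1) (s + 1) * P1_op s A B C = P1_op (s + 2) A B' C' * Eop u v w g h s"
    unfolding Eop_def
    by (rule twisted_op_P1; unfold defs; simp only: laurent_poly_simps poly_Eop; algebra)
  moreover have "P2_op (s + 1) UA UB UC * P1_op s A B C
      + laurent_op [[:s + 3, 1:] * V0, [:0, 1:] * V1] * Eop u v w g h s
    = x_op * laurent_op [0, [:s + 1, 1:] * [:s + 2, 1:] * [:s + 3, 1:] * [:k:],
        [:s + 1, 1:] * [:s + 2, 1:] * [:0, 1:] * [:- k:], [:s + 1, 1:] * [:0, 1:] * [:-1, 1:] * [:0:], 0]"
    unfolding Eop_def k_def cond_acg_def
    by (rule P1_bezout; unfold defs; simp only: laurent_poly_simps poly_Eop poly_diff; algebra)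
  moreover have "x_op * laurent_op [0, [:s + 1, 1:] * [:s + 2, 1:] * [:s + 3, 1:] * [:k:],
        [:s + 1, 1:] * [:s + 2, 1:] * [:0, 1:] * [:- k:], [:s + 1, 1:] * [:0, 1:] * [:-1, 1:] * [:0:], 0]
      = const_op k * (R3 * (R2 * R1))"
    unfolding R1_def R2_def R3_def laurent_op_mult[symmetric] laurent_mult.simps laurent_scale.simps laurent_add.simps
      const_op_laurent_op_2
    by (rule x_laurent_op_eqI, simp, simp only: laurent_poly_simps poly_smult) (intro conjI refl; algebra)
  ultimately show ?thesis
    using R assms(4) intertwines_scale_left k_def by metis
qed

text \<open>This is a \<rightarrow> a + 1, with fixed p and q; \<open>T\<close> consists of two
  steps in p.\<close>

lemma intertwines_a:
  assumes "cond_p u g h s \<noteq> 0" "cond_p u g h (s + 1) \<noteq> 0" "cond_a u v w g s \<noteq> 0"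
  shows "\<exists>P. intertwines P (Eop u v w g h s) (Eop (u + 1) v (w + 1) g h (s + 2))"
proof -
  define R1 R2 where "R1 = laurent_op [[:s + 1, 1:]]" and "R2 = laurent_op [[:s + 2, 1:]]"
  have "s + 1 + 1 = s + 2"
    by simp
  hence "intertwines R1 (Eop u v w g h s) (Eop u v w g h (s + 1))"
    "intertwines R2 (Eop u v w g h (s + 1)) (Eop u v w g h (s + 2))"
    using intertwines_p[OF assms(1), of v w] intertwines_p[OF assms(2), of v w]
    by (simp_all only: R1_def R2_def)
  hence R: "intertwines (R2 * R1) (Eop u v w g h s) (Eop u v w g h (s + 2))"
    by (blast intro: intertwines_mult)
  define k where "k = - cond_a u v w g s"
  define A B C where "A = [:2:] * [:w + 1, 1:] * [:2*w + g + 1, 1:]"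
    and "B = pcompose [:-15-6*h-7*g-2*g*h-14*w-6*w*h-w*g+w^2-v*g-v^2-2*u+u*g-2*u*w+u^2,
        - (2 * (8 + 2*h + 2*g + 3*w + u)), -4:] [:-1, 1:]"
    and "C = [:2:] * [:h + 1, 1:] * [:u + g + h + 1, 1:]"
  define A' B' C' where "A' = [:2:] * [:w + 1, 1:] * [:2*w + g + 2, 1:]"
    and "B' = pcompose [:-23-8*h-7*g-2*g*h-16*w-6*w*h-w*g+w^2-v*g-v^2-2*u+u*g-2*u*w+u^2,
        - (2 * (10 + 2*h + 2*g + 3*w + u)), -4:] [:-1, 1:]"
    and "C' = [:2:] * [:h + 1, 1:] * [:u + g + h + 2, 1:]"
  define b1 b2 where "b1 = b1_poly (u + 1) (v * (v + g)) (w + 1) g h"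
    and "b2 = b2_poly (u + 1) (v * (v + g)) (w + 1) g h"
  define u2 u1 u0 um where "u2 = [:2:] * [:w + 2, 1:] * [:2*w + g + s + 6, 1:]"
    and "u1 = [:s + 3:] * [:2 * (-11-4*h+g^2-4*w-2*w*h+w*g+w^2-v*g-v^2-u+2*u*g+u^2),
        - (2 * (13 + 3*h + 2*g + 2*w + 3*u)), -6:] + b1"
    and "u0 = [:s + 3:] * [:19+18*h+4*h^2-4*g-9*g^2-2*g^2*h-2*g^3+2*w+6*w*h+2*w*h^2-9*w*g-2*w*g*h-3*w*g^2
          -5*w^2-2*w^2*h-w^2*g+5*v*g+2*v*g*h+v*g^2+5*v^2+2*v^2*h+v^2*g+2*u*h-19*u*g-4*u*g*h-7*u*g^2-6*u*w
          -8*u*w*g-2*u*w^2+2*u*v*g+2*u*v^2-9*u^2-2*u^2*h-7*u^2*g-4*u^2*w-2*u^3,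
        2 * (27+19*h+3*h^2+9*g+4*g*h+3*w+2*w*h-w*g-w^2+v*g+v^2+14*u+6*u*h+u*g+u^2),
        2 * (17 + 6*h + 4*g + w + 6*u), 6:] + [:0, 1:] * b2"
    and "um = [:-2:] * [:h + 1, 1:] * [:u + g + h + 2, 1:] * [:2*u + g + h + 3, 1:]"
  define v1 v0 vm where "v1 = [:-2:] * [:w + 1, 1:] * [:2*w + g + s + 5, 1:]"
    and "v0 = [:s + 3:] * [:3+2*h-3*g-2*g^2+2*w+2*w*h-3*w*g-w^2+v*g+v^2-2*u-3*u*g-2*u*w-u^2,
        2 * (5 + 2*h + g + w + u), 4:] + [:0, -1:] * B'"
    and "vm = [:-2:] * [:h + 1, 1:] * [:u + g + h + 2, 1:]"
  note defs = A_def B_def C_def A'_def B'_def C'_def b1_def b2_def u2_def u1_def u0_def um_def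
    v1_def v0_def vm_def
  have "Eop (u + 1) v (w + 1) g h (s + 2) * P2_op s A B C = P2_op (s + 2) A' B' C' * Eop u v w g h s"
    unfolding Eop_def
    by (rule twisted_op_P2; unfold defs; simp only: laurent_poly_simps poly_Eop; algebra)
  moreover have "x_op * (x_op * laurent_op [[:s + 3, 1:] * [:s + 4, 1:] * u2, [:s + 3, 1:] * u1, u0, [:0, 1:] * um])
        * P2_op s A B C
      + x_op * laurent_op [[:s + 3, 1:] * v1, v0, [:0, 1:] * vm] * Eop u v w g h s
    = x_op * (x_op * laurent_op [0, 0, [:s + 1, 1:] * [:s + 2, 1:] * [:k:], 0, 0, 0])"
    unfolding Eop_def k_def cond_a_def
    by (rule P2_bezout; unfold defs; simp only: laurent_poly_simps poly_Eop; algebra)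
  moreover have "x_op * (x_op * laurent_op [0, 0, [:s + 1, 1:] * [:s + 2, 1:] * [:k:], 0, 0, 0])
      = const_op k * (R2 * R1)"
  proof -
    have "[:s + 1, 1:] * [:s + 2, 1:] * [:k:] = smult k ([:s + 2, 1:] * [:s + 1, 1:])"
      by simp
    moreover have "R2 * R1 = laurent_op [[:s + 2, 1:] * [:s + 1, 1:]]"
      unfolding R1_def R2_def laurent_op_mult[symmetric]
      by (simp only: laurent_mult.simps laurent_scale.simps laurent_add.simps laurent_op.simps
          theta_poly_0 mult_zero_right add_0_right)
    ultimately show ?thesis
      unfolding x_op_laurent_op_0
      by (simp only: const_op_laurent_op list.map laurent_op.simps theta_poly_0 mult_zero_right add_0_right theta_poly_smult)
  qed
  moreover have "k \<noteq> 0"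
    using assms(3) by (simp add: k_def)
  ultimately show ?thesis
    using R intertwines_scale_left by metis
qed

section \<open>The order of \<open>Eop\<close>\<close>

definition top_coeff :: "'a :: comm_semiring_0 poly \<Rightarrow> nat \<Rightarrow> 'a \<Rightarrow> bool" where
  "top_coeff f n c \<longleftrightarrow> degree f \<le> n \<and> coeff f n = c"

lemma top_coeff_mult:
  assumes "top_coeff f m c" "top_coeff g n d"
  shows "top_coeff (f * g) (m + n) (c * d)"
proof -
  have "coeff (f * g) (m + n) = (\<Sum>i\<le>m + n. coeff f i * coeff g (m + n - i))"
    by (simp add: coeff_mult)
  also have "\<dots> = (\<Sum>i\<le>m + n. if i = m then c * d else 0)"
    using assms by (intro sum.cong) (auto simp: top_coeff_def coeff_eq_0 not_le nat_neq_iff)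
  finally show ?thesis
    using assms degree_mult_le[of f g] by (auto simp: top_coeff_def)
qed

lemma coeff_theta_op_mult:
  "coeff (op_poly (theta_op * A)) n = to_fract [:0, 1:] *
     (fract_deriv (coeff (op_poly A) n) + (if n = 0 then 0 else coeff (op_poly A) (n - 1)))"
proof -
  have "op_poly (theta_op * A) = smult (to_fract [:0, 1:]) (D_left (op_poly A))"
    by (simp add: theta_op_def x_op_def mult.assoc op_poly_rep_eqs op_comp_def)
  thus ?thesis by (simp add: coeff_D_left)
qed

text \<open>\<theta>^n is x^n \<partial>^n plus terms of lower order.\<close>

lemma coeff_theta_poly:
  assumes "top_coeff f n c"
  shows "(\<forall>m>n. coeff (op_poly (theta_poly f)) m = 0) \<and>
    coeff (op_poly (theta_poly f)) n = to_fract [:c:] * to_fract [:0, 1:] ^ n"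
  using assms
proof (induction f arbitrary: n)
  case 0
  thus ?case by (simp add: top_coeff_def zero_diffop.rep_eq)
next
  case (pCons d f)
  have const: "coeff (op_poly (const_op d)) m = (if m = 0 then to_fract [:d:] else 0)" for m
    by (simp add: const_op_def op_poly_fun_op coeff_pCons split: nat.splits)
  show ?case
  proof (cases n)
    case 0
    hence "f = 0" "c = d"
      using pCons.prems by (auto simp: top_coeff_def split: if_splits)
    thus ?thesis using 0 const by simp
  next
    case (Suc k)
    have "top_coeff f k c"
      using pCons.prems Suc by (auto simp: top_coeff_def split: if_splits)
    hence "\<forall>m>k. coeff (op_poly (theta_poly f)) m = 0"
      "coeff (op_poly (theta_poly f)) k = to_fract [:c:] * to_fract [:0, 1:] ^ k"
      using pCons.IH by blast+
    thus ?thesis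
      using const Suc by (auto simp: plus_diffop.rep_eq coeff_theta_op_mult)
  qed
qed

lemma op_order_laurent:
  assumes "list_all2 (\<lambda>f c. top_coeff f n c) fs cs"
  shows "(\<forall>m>n. coeff (op_poly (laurent_op fs)) m = 0) \<and> coeff (op_poly (laurent_op fs)) n
    = to_fract [:0, 1:] ^ n * foldr (\<lambda>c r. to_fract [:c:] + inverse (to_fract [:0, 1:]) * r) cs 0"
  using assms
proof (induction fs cs rule: list_all2_induct)
  case Nil
  thus ?case by (simp add: zero_diffop.rep_eq)
next
  case (Cons f fs c cs)
  have "coeff (op_poly (x_inv_op * A)) m = inverse (to_fract [:0, 1:]) * coeff (op_poly A) m" for A m
    by (simp add: x_inv_op_def op_poly_rep_eqs op_comp_def)
  thus ?case
    using Cons coeff_theta_poly[of f n c] by (simp add: plus_diffop.rep_eq algebra_simps)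
qed

text \<open>The leading coefficient is 2 x^3 (x - 1)^3. It does not involve the parameters, so the
  order is 5 without any genericity.\<close>

lemma op_order_Eop [simp]: "op_order (Eop u v w g h s) = 5"
proof -
  define X :: ratfun where "X = to_fract [:0, 1:]"
  have lin: "top_coeff [:c, 1 :: complex:] 1 1" for c
    by (simp add: top_coeff_def)
  have "top_coeff (a_poly w g) 2 2" "top_coeff (b1_poly u n w g h) 3 (- 6)"
     "top_coeff (b2_poly u n w g h) 3 6" "top_coeff (y_poly u g h) 3 (- 2)" for n
    unfolding a_poly_def b1_poly_def b2_poly_def y_poly_def
    by (simp_all add: top_coeff_def pcompose_pCons numeral_eq_Suc)
  note top = this
  have "top_coeff ([:s + 1, 1:] * [:s + 2, 1:] * [:s + 3, 1:] * a_poly w g) 5 2"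
    using top_coeff_mult[OF top_coeff_mult[OF top_coeff_mult[OF lin lin] lin] top(1), of "s + 1" "s + 2" "s + 3"]
    by (simp only: mult_1 mult_1_right) (simp add: numeral_eq_Suc)
  moreover have "top_coeff ([:s + 1, 1:] * [:s + 2, 1:] * b1_poly u n w g h) 5 (- 6)" for n
    using top_coeff_mult[OF top_coeff_mult[OF lin lin] top(2), of "s + 1" "s + 2" n]
    by (simp only: mult_1 mult_1_right) (simp add: numeral_eq_Suc)
  moreover have "top_coeff ([:s + 1, 1:] * [:0, 1:] * b2_poly u n w g h) 5 6" for n
    using top_coeff_mult[OF top_coeff_mult[OF lin lin] top(3), of "s + 1" 0 n]
    by (simp only: mult_1 mult_1_right) (simp add: numeral_eq_Suc)
  moreover have "top_coeff ([:0, 1:] * [:-1, 1:] * y_poly u g h) 5 (- 2)"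
    using top_coeff_mult[OF top_coeff_mult[OF lin lin] top(4), of 0 "-1"]
    by (simp only: mult_1 mult_1_right) (simp add: numeral_eq_Suc)
  ultimately have tops: "list_all2 (\<lambda>f c. top_coeff f 5 c)
     [[:s + 1, 1:] * [:s + 2, 1:] * [:s + 3, 1:] * a_poly w g, [:s + 1, 1:] * [:s + 2, 1:] * b1_poly u n w g h,
      [:s + 1, 1:] * [:0, 1:] * b2_poly u n w g h, [:0, 1:] * [:-1, 1:] * y_poly u g h] [2, -6, 6, -2]" for n
    by (simp del: mult_pCons_left mult_pCons_right)
  have X: "X \<noteq> 0" "X - 1 \<noteq> 0"
    by (simp_all add: X_def flip: to_fract_1 to_fract_diff) (simp_all add: one_pCons)
  define r where "r = foldr (\<lambda>c r. to_fract [:c:] + inverse X * r) [2, -6, 6, -2 :: complex] 0"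
  have c: "to_fract [:2 :: complex:] = 2" "to_fract [:-6 :: complex:] = -6" "to_fract [:6 :: complex:] = 6"
    "to_fract [:-2 :: complex:] = -2"
  proof -
    have "[:2 :: complex:] = 1 + 1" "[:6 :: complex:] = 1 + 1 + 1 + 1 + 1 + 1"
      "[:-6 :: complex:] = 0 - [:6:]" "[:-2 :: complex:] = 0 - [:2:]"
      by (simp_all add: one_pCons)
    thus "to_fract [:2 :: complex:] = 2" "to_fract [:-6 :: complex:] = -6" "to_fract [:6 :: complex:] = 6"
      "to_fract [:-2 :: complex:] = -2"
      by (simp_all only: to_fract_add to_fract_diff to_fract_1 to_fract_0) simp_all
  qed
  have "X ^ 3 * r = 2 * (X - 1) ^ 3"
    using X(1) by (simp add: r_def c field_simps power3_eq_cube)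
  moreover have "(2 :: ratfun) \<noteq> 0"
    using c(1) by (metis one_pCons pCons_eq_0_iff to_fract_eq_0_iff zero_neq_numeral)
  ultimately have r: "r \<noteq> 0" using X by auto
  have x: "coeff (op_poly (x_op * A)) m = X * coeff (op_poly A) m" for A m
    by (simp add: X_def x_op_def op_poly_rep_eqs op_comp_def)
  have "coeff (op_poly (Eop u v w g h s)) m = 0" if "m > 5" for m
    unfolding Eop_def twisted_op_def x using op_order_laurent[OF tops] that by simp
  moreover have "coeff (op_poly (Eop u v w g h s)) 5 \<noteq> 0"
    unfolding Eop_def twisted_op_def x using op_order_laurent[OF tops] r X by (simp add: r_def X_def)
  ultimately show ?thesis
    unfolding op_order.rep_eq by (intro antisym degree_le le_degree) auto
qed

subsection \<open>Generic parameters\<close>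

lemma polyfun6_uminus:
  assumes "polyfun6 F" shows "polyfun6 (\<lambda>a b c g p q. - F a b c g p q)"
  using polyfun6.intros(9)[OF polyfun6.intros(1)[of "-1"] assms] by simp

lemma polyfun6_diff:
  assumes "polyfun6 F" "polyfun6 G" shows "polyfun6 (\<lambda>a b c g p q. F a b c g p q - G a b c g p q)"
  using polyfun6.intros(8)[OF assms(1) polyfun6_uminus[OF assms(2)]] by simp

lemmas polyfun6_intros = polyfun6.intros polyfun6_uminus polyfun6_diff

lemma polyfun6_translate:
  assumes "polyfun6 F"
  shows "polyfun6 (\<lambda>a b c g p q. F (a + a') (b + b') (c + c') (g + g') (p + p') (q + q'))"
  using assms by induction (auto intro!: polyfun6_intros)

lemma polyfun6_line:
  assumes "polyfun6 F"
  shows "\<exists>f. \<forall>t. F (a + t * a') (b + t * b') (c + t * c') (g + t * g') (p + t * p') (q + t * q') = poly f t"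
proof -
  have lin: "\<exists>f. \<forall>t. x + t * y = poly f t" for x y :: complex
    by (rule exI[of _ "[:x, y:]"]) simp
  show ?thesis
  using assms
proof induction
  case (1 k)
  show ?case by (rule exI[of _ "[:k:]"]) simp
next
  case (8 F G)
  then obtain f f' where
    "\<forall>t. F (a + t * a') (b + t * b') (c + t * c') (g + t * g') (p + t * p') (q + t * q') = poly f t"
    "\<forall>t. G (a + t * a') (b + t * b') (c + t * c') (g + t * g') (p + t * p') (q + t * q') = poly f' t"
    by blast
  thus ?case by (intro exI[of _ "f + f'"]) simp
next
  case (9 F G)
  then obtain f f' where
    "\<forall>t. F (a + t * a') (b + t * b') (c + t * c') (g + t * g') (p + t * p') (q + t * q') = poly f t"
    "\<forall>t. G (a + t * a') (b + t * b') (c + t * c') (g + t * g') (p + t * p') (q + t * q') = poly f' t"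
    by blast
  thus ?case by (intro exI[of _ "f * f'"]) simp
qed (rule lin)+
qed

lemma generically_mono:
  assumes "generically \<Phi>" "\<And>a b c g p q. \<Phi> a b c g p q \<Longrightarrow> \<Psi> a b c g p q"
  shows "generically \<Psi>"
proof -
  obtain F where "polyfun6 F" "\<exists>a b c g p q. F a b c g p q \<noteq> 0"
    "\<And>a b c g p q. F a b c g p q \<noteq> 0 \<Longrightarrow> \<Phi> a b c g p q"
    using assms(1) unfolding generically_def by blast
  thus ?thesis
    unfolding generically_def using assms(2) by (intro exI[of _ F]) simp
qed

text \<open>On the line through a non-zero of \<open>F\<close> and a non-zero of \<open>G\<close>,
  both become non-zero polynomials in one variable, and so does their product.\<close>

lemma generically_conj:
  assumes "generically \<Phi>" "generically \<Psi>"
  shows "generically (\<lambda>a b c g p q. \<Phi> a b c g p q \<and> \<Psi> a b c g p q)"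
proof -
  obtain F a b c g p q where F: "polyfun6 F" "F a b c g p q \<noteq> 0"
    "\<And>a b c g p q. F a b c g p q \<noteq> 0 \<Longrightarrow> \<Phi> a b c g p q"
    using assms(1) unfolding generically_def by blast
  obtain G a' b' c' g' p' q' where G: "polyfun6 G" "G a' b' c' g' p' q' \<noteq> 0"
    "\<And>a b c g p q. G a b c g p q \<noteq> 0 \<Longrightarrow> \<Psi> a b c g p q"
    using assms(2) unfolding generically_def by blast
  let ?L = "\<lambda>H t. H (a + t * (a' - a)) (b + t * (b' - b)) (c + t * (c' - c)) (g + t * (g' - g))
      (p + t * (p' - p)) (q + t * (q' - q))"
  obtain f where f: "\<And>t. ?L F t = poly f t" using polyfun6_line[OF F(1)] by blast
  obtain f' where f': "\<And>t. ?L G t = poly f' t" using polyfun6_line[OF G(1)] by blast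
  have "poly f 0 \<noteq> 0" "poly f' 1 \<noteq> 0"
    using F(2) G(2) f[of 0] f'[of 1] by simp_all
  hence "f * f' \<noteq> 0" by auto
  then obtain t where "poly (f * f') t \<noteq> 0"
    using poly_all_0_iff_0 by blast
  hence "?L F t * ?L G t \<noteq> 0"
    unfolding f f' by simp
  hence "\<exists>a b c g p q. F a b c g p q * G a b c g p q \<noteq> 0"
    by blast
  thus ?thesis
    unfolding generically_def using polyfun6.intros(9)[OF F(1) G(1)] F(3) G(3)
    by (intro exI[of _ "\<lambda>a b c g p q. F a b c g p q * G a b c g p q"]) auto
qed

lemma generically_translate:
  assumes "generically \<Phi>"
  shows "generically (\<lambda>a b c g p q. \<Phi> (a + a') (b + b') (c + c') (g + g') (p + p') (q + q'))"
proof -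
  obtain F a b c g p q where F: "polyfun6 F" "F a b c g p q \<noteq> 0"
    "\<And>a b c g p q. F a b c g p q \<noteq> 0 \<Longrightarrow> \<Phi> a b c g p q"
    using assms(1) unfolding generically_def by blast
  have "F (a - a' + a') (b - b' + b') (c - c' + c') (g - g' + g') (p - p' + p') (q - q' + q') \<noteq> 0"
    using F(2) by simp
  thus ?thesis
    unfolding generically_def
    using polyfun6_translate[OF F(1), of a' b' c' g' p' q'] F(3) by blast
qed

subsection \<open>The lattice of shifts\<close>

definition SE5_shift :: "complex \<Rightarrow> complex \<Rightarrow> complex \<Rightarrow> complex \<Rightarrow> complex \<Rightarrow> complex \<Rightarrow> bool" where
  "SE5_shift a' b' c' g' p' q' \<longleftrightarrow> generically (\<lambda>a b c g p q.
     \<exists>P. intertwines P (SE5 a b c g p q) (SE5 (a + a') (b + b') (c + c') (g + g') (p + p') (q + q')))"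

lemma SE5_order [simp]: "op_order (SE5 a b c g p q) = 5"
proof -
  have "op_order (const_op 2 * SE5 a b c g p q) = 5"
    by (simp flip: Eop_eq_SE5)
  moreover have "op_order (const_op 2) = 0"
    by (simp add: const_op_def op_order.rep_eq op_poly_fun_op)
  moreover have "op_order 0 = 0"
    by (simp add: op_order.rep_eq zero_diffop.rep_eq)
  ultimately have "const_op 2 \<noteq> 0" "SE5 a b c g p q \<noteq> 0"
    by auto
  thus ?thesis
    using op_order_mult \<open>op_order (const_op 2 * SE5 a b c g p q) = 5\<close> \<open>op_order (const_op 2) = 0\<close> by simp
qed

lemma SE5_nonzero [simp]: "SE5 a b c g p q \<noteq> 0"
  using SE5_order[of a b c g p q] by (auto simp: op_order.rep_eq zero_diffop.rep_eq)

lemma intertwines_SE5: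
  assumes "intertwines P (Eop u v w g h s) (Eop u' v' w' g'' h' s')"
    and "u = a + c + 1" "v = b + c + 1" "w = a + b + 1" "h = 2*b + q" "s = 2*a + 2*b + 2*c + g + p + q + 3"
    and "g'' = g'" "u' = a' + c' + 1" "v' = b' + c' + 1" "w' = a' + b' + 1" "h' = 2*b' + q'"
      "s' = 2*a' + 2*b' + 2*c' + g' + p' + q' + 3"
  shows "\<exists>P. intertwines P (SE5 a b c g p q) (SE5 a' b' c' g' p' q')"
proof -
  obtain Q U V where "const_op 2 * SE5 a' b' c' g' p' q' * P = Q * (const_op 2 * SE5 a b c g p q)"
    "U * P + V * (const_op 2 * SE5 a b c g p q) = 1"
    using assms(1) unfolding assms(2-) Eop_eq_SE5 intertwines_def by blast
  note this(1)[THEN arg_cong[of _ _ "\<lambda>A. const_op (inverse 2) * A"]] this(2)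
  moreover have "const_op (inverse 2) * (const_op 2 * A) = A" for A
    by (simp add: const_op_1 flip: mult.assoc const_op_mult)
  ultimately have "SE5 a' b' c' g' p' q' * P = (const_op (inverse 2) * Q * const_op 2) * SE5 a b c g p q"
    "U * P + (V * const_op 2) * SE5 a b c g p q = 1"
    by (simp_all only: mult.assoc)
  thus ?thesis
    unfolding intertwines_def by blast
qed

text \<open>The second intertwiner starts at the shifted parameters, so its exceptional set has to
  be translated.\<close>

lemma SE5_shift_add:
  assumes "SE5_shift a b c g p q" "SE5_shift a' b' c' g' p' q'"
  shows "SE5_shift (a + a') (b + b') (c + c') (g + g') (p + p') (q + q')"
  unfolding SE5_shift_def
proof (rule generically_mono[OF generically_conj[OF
    assms(1)[unfolded SE5_shift_def]
    generically_translate[OF assms(2)[unfolded SE5_shift_def], of a b c g p q]]])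
qed (auto dest: intertwines_mult simp: add.assoc)

text \<open>The inverse intertwiner starts at the shifted parameters; translating back makes these
  the free ones.\<close>

lemma SE5_shift_minus:
  assumes "SE5_shift a b c g p q"
  shows "SE5_shift (- a) (- b) (- c) (- g) (- p) (- q)"
  unfolding SE5_shift_def
proof (rule generically_mono[OF generically_translate[OF assms[unfolded SE5_shift_def],
    of "- a" "- b" "- c" "- g" "- p" "- q"]])
qed (auto dest!: intertwines_inverse)

section \<open>Generators of the lattice of shifts and the unit shifts\<close>

lemma genericallyI:
  assumes "polyfun6 F" "F a b c g p q \<noteq> 0" "\<And>a b c g p q. F a b c g p q \<noteq> 0 \<Longrightarrow> \<Phi> a b c g p q"
  shows "generically \<Phi>"
  using assms unfolding generically_def by blast

text \<open>For fixed \<open>s\<close> this reflection exchanges e4 and e6 and fixes e5.\<close>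

lemma Eop_reflect: "Eop u (- v - g) w g h s = Eop u v w g h s"
proof -
  have "(- v - g) * (- v - g + g) = v * (v + g)"
    by algebra
  thus ?thesis by (simp only: Eop_def)
qed

lemma SE5_shift_p: "SE5_shift 0 0 0 0 1 0"
  unfolding SE5_shift_def
proof (rule genericallyI)
  let ?F = "\<lambda>a b c g p q. cond_p (a + c + 1) g (2*b + q) (2*a + 2*b + 2*c + g + p + q + 3)"
  show "polyfun6 ?F"
    unfolding cond_defs by (intro polyfun6_intros)
  \<comment> \<open>The coordinates are so far apart that none of the linear factors vanishes; the
    same point serves all generators.\<close>
  show "?F 1 10 100 1000 10000 100000 \<noteq> 0"
    by (simp add: cond_defs)
  fix a b c g p q assume "?F a b c g p q \<noteq> 0"
  hence F: "cond_p (a + c + 1) g (2*b + q) (2*a + 2*b + 2*c + g + p + q + 3) \<noteq> 0"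
    by simp_all
  show "\<exists>P. intertwines P (SE5 a b c g p q) (SE5 (a + 0) (b + 0) (c + 0) (g + 0) (p + 1) (q + 0))"
    by (rule intertwines_SE5[OF intertwines_p[OF F, of "b + c + 1" "a + b + 1"]]) simp_all
qed

lemma SE5_shift_q: "SE5_shift 0 0 0 0 0 1"
  unfolding SE5_shift_def
proof (rule genericallyI)
  let ?F = "\<lambda>a b c g p q. cond_q (a + c + 1) (b + c + 1) (a + b + 1) g (2*b + q) (2*a + 2*b + 2*c + g + p + q + 3)"
  show "polyfun6 ?F"
    unfolding cond_defs by (intro polyfun6_intros)
  show "?F 1 10 100 1000 10000 100000 \<noteq> 0"
    by (simp add: cond_defs)
  fix a b c g p q assume "?F a b c g p q \<noteq> 0"
  hence F: "cond_q (a + c + 1) (b + c + 1) (a + b + 1) g (2*b + q) (2*a + 2*b + 2*c + g + p + q + 3) \<noteq> 0"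
    by simp_all
  show "\<exists>P. intertwines P (SE5 a b c g p q) (SE5 (a + 0) (b + 0) (c + 0) (g + 0) (p + 0) (q + 1))"
    by (rule intertwines_SE5[OF intertwines_q[OF F]]) simp_all
qed

lemma SE5_shift_ag: "SE5_shift (- 1) 0 0 2 1 0"
  unfolding SE5_shift_def
proof (rule genericallyI)
  let ?F = "\<lambda>a b c g p q. cond_q (a + c + 1) (b + c + 1) (a + b + 1) g (2*b + q) (2*a + 2*b + 2*c + g + p + q + 3) * cond_q (a + c + 1) (b + c + 1) (a + b + 1) g ((2*b + q) + 1) ((2*a + 2*b + 2*c + g + p + q + 3) + 1) * cond_p (a + c + 1) g ((2*b + q) + 2) ((2*a + 2*b + 2*c + g + p + q + 3) + 2) * cond_ag (a + c + 1) (b + c + 1) (a + b + 1) g"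
  show "polyfun6 ?F"
    unfolding cond_defs by (intro polyfun6_intros)
  show "?F 1 10 100 1000 10000 100000 \<noteq> 0"
    by (simp add: cond_defs)
  fix a b c g p q assume "?F a b c g p q \<noteq> 0"
  hence F: "cond_q (a + c + 1) (b + c + 1) (a + b + 1) g (2*b + q) (2*a + 2*b + 2*c + g + p + q + 3) \<noteq> 0" "cond_q (a + c + 1) (b + c + 1) (a + b + 1) g ((2*b + q) + 1) ((2*a + 2*b + 2*c + g + p + q + 3) + 1) \<noteq> 0" "cond_p (a + c + 1) g ((2*b + q) + 2) ((2*a + 2*b + 2*c + g + p + q + 3) + 2) \<noteq> 0" "cond_ag (a + c + 1) (b + c + 1) (a + b + 1) g \<noteq> 0"
    by simp_all
  obtain P where "intertwines P (Eop (a + c + 1) (b + c + 1) (a + b + 1) g (2*b + q) (2*a + 2*b + 2*c + g + p + q + 3)) (Eop ((a + c + 1) - 1) (b + c + 1) ((a + b + 1) - 1) (g + 2) (2*b + q) ((2*a + 2*b + 2*c + g + p + q + 3) + 1))"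
    using intertwines_ag[OF F] by blast
  thus "\<exists>P. intertwines P (SE5 a b c g p q) (SE5 (a + - 1) (b + 0) (c + 0) (g + 2) (p + 1) (q + 0))"
    by (rule intertwines_SE5) simp_all
qed

text \<open>The mirror image of \<open>SE5_shift_ag\<close>. As -v - g stays fixed while g grows by
  2, \<open>v\<close> drops by 2.\<close>

lemma SE5_shift_bcg: "SE5_shift 0 (- 1) (- 1) 2 1 2"
  unfolding SE5_shift_def
proof (rule genericallyI)
  let ?F = "\<lambda>a b c g p q. cond_q (a + c + 1) (- (b + c + 1) - g) (a + b + 1) g (2*b + q) (2*a + 2*b + 2*c + g + p + q + 3) * cond_q (a + c + 1) (- (b + c + 1) - g) (a + b + 1) g ((2*b + q) + 1) ((2*a + 2*b + 2*c + g + p + q + 3) + 1) * cond_p (a + c + 1) g ((2*b + q) + 2) ((2*a + 2*b + 2*c + g + p + q + 3) + 2) * cond_ag (a + c + 1) (- (b + c + 1) - g) (a + b + 1) g"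
  show "polyfun6 ?F"
    unfolding cond_defs by (intro polyfun6_intros)
  show "?F 1 10 100 1000 10000 100000 \<noteq> 0"
    by (simp add: cond_defs)
  fix a b c g p q assume "?F a b c g p q \<noteq> 0"
  hence F: "cond_q (a + c + 1) (- (b + c + 1) - g) (a + b + 1) g (2*b + q) (2*a + 2*b + 2*c + g + p + q + 3) \<noteq> 0" "cond_q (a + c + 1) (- (b + c + 1) - g) (a + b + 1) g ((2*b + q) + 1) ((2*a + 2*b + 2*c + g + p + q + 3) + 1) \<noteq> 0" "cond_p (a + c + 1) g ((2*b + q) + 2) ((2*a + 2*b + 2*c + g + p + q + 3) + 2) \<noteq> 0" "cond_ag (a + c + 1) (- (b + c + 1) - g) (a + b + 1) g \<noteq> 0"
    by simp_all
  obtain P where "intertwines P (Eop (a + c + 1) (- (b + c + 1) - g) (a + b + 1) g (2*b + q) (2*a + 2*b + 2*c + g + p + q + 3)) (Eop ((a + c + 1) - 1) (- (b + c + 1) - g) ((a + b + 1) - 1) (g + 2) (2*b + q) ((2*a + 2*b + 2*c + g + p + q + 3) + 1))"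
    using intertwines_ag[OF F] by blast
  moreover have "(- (b + c + 1) - g) = - ((b + c + 1) - 2) - (g + 2)"
    by simp
  ultimately have "intertwines P (Eop (a + c + 1) (b + c + 1) (a + b + 1) g (2*b + q) (2*a + 2*b + 2*c + g + p + q + 3)) (Eop ((a + c + 1) - 1) ((b + c + 1) - 2) ((a + b + 1) - 1) (g + 2) (2*b + q) ((2*a + 2*b + 2*c + g + p + q + 3) + 1))"
    by (metis Eop_reflect)
  thus "\<exists>P. intertwines P (SE5 a b c g p q) (SE5 (a + 0) (b + - 1) (c + - 1) (g + 2) (p + 1) (q + 2))"
    by (rule intertwines_SE5) simp_all
qed

lemma SE5_shift_acg: "SE5_shift (- 1) 0 (- 1) 2 2 1"
  unfolding SE5_shift_def
proof (rule genericallyI)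
  let ?F = "\<lambda>a b c g p q. cond_q (a + c + 1) (b + c + 1) (a + b + 1) g (2*b + q) (2*a + 2*b + 2*c + g + p + q + 3) * cond_p (a + c + 1) g ((2*b + q) + 1) ((2*a + 2*b + 2*c + g + p + q + 3) + 1) * cond_p (a + c + 1) g ((2*b + q) + 1) ((2*a + 2*b + 2*c + g + p + q + 3) + 2) * cond_acg (a + c + 1) (b + c + 1) (a + b + 1) g"
  show "polyfun6 ?F"
    unfolding cond_defs by (intro polyfun6_intros)
  show "?F 1 10 100 1000 10000 100000 \<noteq> 0"
    by (simp add: cond_defs)
  fix a b c g p q assume "?F a b c g p q \<noteq> 0"
  hence F: "cond_q (a + c + 1) (b + c + 1) (a + b + 1) g (2*b + q) (2*a + 2*b + 2*c + g + p + q + 3) \<noteq> 0" "cond_p (a + c + 1) g ((2*b + q) + 1) ((2*a + 2*b + 2*c + g + p + q + 3) + 1) \<noteq> 0" "cond_p (a + c + 1) g ((2*b + q) + 1) ((2*a + 2*b + 2*c + g + p + q + 3) + 2) \<noteq> 0" "cond_acg (a + c + 1) (b + c + 1) (a + b + 1) g \<noteq> 0"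
    by simp_all
  obtain P where "intertwines P (Eop (a + c + 1) (b + c + 1) (a + b + 1) g (2*b + q) (2*a + 2*b + 2*c + g + p + q + 3)) (Eop ((a + c + 1) - 2) ((b + c + 1) - 1) ((a + b + 1) - 1) (g + 2) ((2*b + q) + 1) ((2*a + 2*b + 2*c + g + p + q + 3) + 1))"
    using intertwines_acg[OF F] by blast
  thus "\<exists>P. intertwines P (SE5 a b c g p q) (SE5 (a + - 1) (b + 0) (c + - 1) (g + 2) (p + 2) (q + 1))"
    by (rule intertwines_SE5) simp_all
qed

lemma SE5_shift_a: "SE5_shift 1 0 0 0 0 0"
  unfolding SE5_shift_def
proof (rule genericallyI)
  let ?F = "\<lambda>a b c g p q. cond_p (a + c + 1) g (2*b + q) (2*a + 2*b + 2*c + g + p + q + 3) * cond_p (a + c + 1) g (2*b + q) ((2*a + 2*b + 2*c + g + p + q + 3) + 1) * cond_a (a + c + 1) (b + c + 1) (a + b + 1) g (2*a + 2*b + 2*c + g + p + q + 3)"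
  show "polyfun6 ?F"
    unfolding cond_defs by (intro polyfun6_intros)
  show "?F 1 10 100 1000 10000 100000 \<noteq> 0"
    by (simp add: cond_defs)
  fix a b c g p q assume "?F a b c g p q \<noteq> 0"
  hence F: "cond_p (a + c + 1) g (2*b + q) (2*a + 2*b + 2*c + g + p + q + 3) \<noteq> 0" "cond_p (a + c + 1) g (2*b + q) ((2*a + 2*b + 2*c + g + p + q + 3) + 1) \<noteq> 0" "cond_a (a + c + 1) (b + c + 1) (a + b + 1) g (2*a + 2*b + 2*c + g + p + q + 3) \<noteq> 0"
    by simp_all
  obtain P where "intertwines P (Eop (a + c + 1) (b + c + 1) (a + b + 1) g (2*b + q) (2*a + 2*b + 2*c + g + p + q + 3)) (Eop ((a + c + 1) + 1) (b + c + 1) ((a + b + 1) + 1) g (2*b + q) ((2*a + 2*b + 2*c + g + p + q + 3) + 2))"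
    using intertwines_a[OF F] by blast
  thus "\<exists>P. intertwines P (SE5 a b c g p q) (SE5 (a + 1) (b + 0) (c + 0) (g + 0) (p + 0) (q + 0))"
    by (rule intertwines_SE5) simp_all
qed

lemma SE5_shift_g: "SE5_shift 0 0 0 2 0 0"
  using SE5_shift_add[OF SE5_shift_add[OF SE5_shift_ag SE5_shift_a] SE5_shift_minus[OF SE5_shift_p]] by simp

lemma SE5_shift_c: "SE5_shift 0 0 1 0 0 0"
  using SE5_shift_add[OF SE5_shift_add[OF SE5_shift_add[OF SE5_shift_ag SE5_shift_minus[OF SE5_shift_acg]]
    SE5_shift_p] SE5_shift_q] by simp

lemma SE5_shift_b: "SE5_shift 0 1 0 0 0 0"
  using SE5_shift_add[OF SE5_shift_add[OF SE5_shift_add[OF SE5_shift_add[OF SE5_shift_add[OF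
    SE5_shift_minus[OF SE5_shift_bcg] SE5_shift_g] SE5_shift_minus[OF SE5_shift_c]]
    SE5_shift_p] SE5_shift_q] SE5_shift_q] by simp

text \<open>The sign -1 comes from the inverse intertwiner; both are then reduced to order below
  5.\<close>

lemma SE5_shift_pm:
  assumes "SE5_shift a' b' c' g' p' q'"
  shows "generically (\<lambda>a b c g p q. \<forall>\<epsilon> \<in> {1, -1}. \<exists>P. shift_operator (SE5 a b c g p q)
     (SE5 (a + \<epsilon> * a') (b + \<epsilon> * b') (c + \<epsilon> * c') (g + \<epsilon> * g') (p + \<epsilon> * p') (q + \<epsilon> * q')) P)"
  by (rule generically_mono[OF generically_conj[OF assms[unfolded SE5_shift_def]
      SE5_shift_minus[OF assms, unfolded SE5_shift_def]]])
    (auto dest!: intertwines_shift_operator)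

theorem theorem8p2:
  shows "generically (\<lambda>a b c g p q. \<forall>\<epsilon> \<in> {1, -1}.
      (\<exists>P. shift_operator (SE5 a b c g p q) (SE5 (a + \<epsilon>) b c g p q) P) \<and>
      (\<exists>P. shift_operator (SE5 a b c g p q) (SE5 a (b + \<epsilon>) c g p q) P) \<and>
      (\<exists>P. shift_operator (SE5 a b c g p q) (SE5 a b (c + \<epsilon>) g p q) P) \<and>
      (\<exists>P. shift_operator (SE5 a b c g p q) (SE5 a b c (g + 2 * \<epsilon>) p q) P) \<and>
      (\<exists>P. shift_operator (SE5 a b c g p q) (SE5 a b c g (p + \<epsilon>) q) P) \<and>
      (\<exists>P. shift_operator (SE5 a b c g p q) (SE5 a b c g p (q + \<epsilon>)) P))"
  by (rule generically_mono[OF generically_conj[OF SE5_shift_pm[OF SE5_shift_a]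
      generically_conj[OF SE5_shift_pm[OF SE5_shift_b] generically_conj[OF SE5_shift_pm[OF SE5_shift_c]
      generically_conj[OF SE5_shift_pm[OF SE5_shift_g] generically_conj[OF SE5_shift_pm[OF SE5_shift_p]
        SE5_shift_pm[OF SE5_shift_q]]]]]]])
    (simp add: mult.commute)

end
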